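(* Let $n\ge 2$ be an integer. For every $\epsilon>0$ there is a constant $C_{n,\epsilon}>0$ such that for every positive integer $q$ there exists an element $x\in\mathrm{SL}_n(\mathbb{Z}/q\mathbb{Z})$ with \[ \min\{\|\gamma\|:\gamma\in\mathrm{SL}_n(\mathbb{Z}),\ \pi_q(\gamma)=x\}\ge C_{n,\epsilon}\,q^{2-\epsilon}. \]
   Context: $\pi_q\colon\mathrm{SL}_n(\mathbb{Z})\to\mathrm{SL}_n(\mathbb{Z}/q\mathbb{Z})$ denotes reduction modulo $q$ (which is surjective), and $\|\cdot\|$ denotes the operator norm of a matrix. *)

theory Defs
  imports "HOL-Analysis.Analysis" "HOL-Number_Theory.Number_Theory"
begin

definition SL_int :: "(int ^ 'n ^ 'n) set" where
  "SL_int = {A. det A = 1}"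

text \<open>
  An element of \<open>\<int>/q\<int>\<close> is represented by its canonical representative in \<open>{0..<q}\<close>, as in
  \<^const>\<open>residue_ring\<close>. The determinant over \<open>\<int>/q\<int>\<close> is the integer determinant of the
  representatives reduced modulo \<open>q\<close>. For \<open>q = 1\<close> the only element is the zero matrix.
\<close>
definition SL_mod :: "nat \<Rightarrow> (int ^ 'n ^ 'n) set" where
  "SL_mod q = {A. (\<forall>i j. A $ i $ j \<in> carrier (residue_ring (int q))) \<and> [det A = 1] (mod int q)}"

definition reduce_mod :: "nat \<Rightarrow> int ^ 'n ^ 'n \<Rightarrow> int ^ 'n ^ 'n" where
  "reduce_mod q A = map_matrix (\<lambda>a. a mod int q) A"

definition op_norm :: "int ^ 'n ^ 'n \<Rightarrow> real" where
  "op_norm A = onorm (\<lambda>v :: real ^ 'n. map_matrix real_of_int A *v v)"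

end

theory Submission
  imports Defs "HOL-Library.Poly_Mapping" "HOL-Library.Function_Algebras"
begin

text \<open>
  Let \<open>n = CARD('n)\<close>, and suppose \<open>k ^ n\<close> is congruent modulo \<open>q\<^sup>2\<close> to a small positive integer
  \<open>D\<close>. If \<open>\<gamma>\<close> has determinant 1 and reduces modulo \<open>q\<close> to the diagonal matrix with entries
  \<open>k / D, k, \<dots>, k\<close>, then linearising the determinant shows that the integer
  \<open>D * \<gamma>\<^sub>1\<^sub>1 + \<gamma>\<^sub>2\<^sub>2 + \<dots> + \<gamma>\<^sub>n\<^sub>n\<close> is congruent to \<open>n * k\<close> modulo \<open>q\<^sup>2\<close>. Hence the norm of
  \<open>\<gamma>\<close> is large as soon as \<open>n * k\<close> has no small representative modulo \<open>q\<^sup>2\<close>.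

  To find such a \<open>k\<close>, take primes \<open>l\<^sub>0, \<dots>, l\<^sub>r\<close> of size at most a small power of \<open>q\<close> in the same
  coset of the \<open>n\<close>-th powers modulo \<open>q\<^sup>2\<close> (there are only \<open>q\<close> to the \<open>o(1)\<close> cosets), so that the
  numbers \<open>l\<^sub>i * l\<^sub>r ^ (n - 1)\<close> have \<open>n\<close>-th roots \<open>\<kappa>\<^sub>i\<close>. If all the monomials in the \<open>\<kappa>\<^sub>i\<close>, times
  \<open>n\<close>, had small representatives, these would extend to an integer-valued functional on the ring
  generated by formal radicals. By the pigeonhole principle the \<open>2 ^ r\<close> squarefree monomials in the
  \<open>\<kappa>\<^sub>i\<close> satisfy a linear relation modulo \<open>q\<^sup>2\<close> with coefficients of size at most
  \<open>q\<close> to the \<open>2 / 2 ^ r\<close>, and by smallness the functional would annihilate the corresponding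
  element. This contradicts the linear independence of squarefree monomials in radicals, which
  holds in any such quotient by descent at the primes \<open>l\<^sub>i\<close>.
\<close>

section \<open>Functionals on rings generated by radicals\<close>

lemma fermat_theorem_int:
  fixes p :: nat and a :: int
  assumes p: "prime p" and a: "\<not> int p dvd a"
  shows "[a ^ (p - 1) = 1] (mod int p)"
proof -
  define b where "b = nat (a mod int p)"
  have b: "int b = a mod int p"
    using p prime_gt_0_nat by (simp add: b_def)
  then have ab: "[a = int b] (mod int p)" by (simp add: cong_def)
  then have "\<not> p dvd b" using a b by (metis dvd_mod_iff dvd_refl int_dvd_int_iff)
  then have "[b ^ (p - 1) = 1] (mod p)" using p by (intro fermat_theorem)
  then have "[int b ^ (p - 1) = 1] (mod int p)"
    by (metis cong_int_iff of_nat_1 of_nat_power)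
  with cong_pow[OF ab] show ?thesis by (rule cong_trans)
qed

text \<open>\<open>X\<close> is additive only; later it sends a monomial in formal radicals to an
  integer in its residue class. The law \<open>X_radical\<close> says that \<open>X\<close> cannot
  tell \<open>t i ^ n\<close> from \<open>D i\<close>. Modulo the ideal that \<open>X\<close>
  ignores, \<open>t i\<close> is therefore an \<open>n\<close>-th root of \<open>D i\<close>, and no
  number field has to be built.\<close>

locale radical_functional =
  fixes X :: "'a::comm_ring_1 \<Rightarrow> int" and t :: "nat \<Rightarrow> 'a" and D :: "nat \<Rightarrow> int" and n :: nat
  assumes X_add: "X (a + b) = X a + X b"
    and X_radical: "X (t i ^ n * g) = D i * X g"
begin

text \<open>Congruence modulo the largest ideal contained in the kernel of \<open>X\<close>.\<close>
definition eqv :: "'a \<Rightarrow> 'a \<Rightarrow> bool" (infix \<open>\<sim>\<close> 50) where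
  "a \<sim> b \<longleftrightarrow> (\<forall>g. X (a * g) = X (b * g))"

lemma X_zero [simp]: "X 0 = 0"
  using X_add[of 0 0] by simp

lemma X_minus: "X (- a) = - X a"
  using X_add[of a "- a"] by simp

lemma X_of_nat: "X (of_nat k * a) = int k * X a"
  by (induction k) (simp_all add: X_add algebra_simps)

lemma X_of_int: "X (of_int c * a) = c * X a"
  by (cases c rule: int_cases2) (simp_all add: X_of_nat X_minus)

lemma eqv_refl [simp]: "a \<sim> a"
  by (simp add: eqv_def)

lemma eqv_sym: "a \<sim> b \<Longrightarrow> b \<sim> a"
  by (simp add: eqv_def)

lemma eqv_trans [trans]: "a \<sim> b \<Longrightarrow> b \<sim> c \<Longrightarrow> a \<sim> c"
  by (simp add: eqv_def)

lemma eqv_add: "a \<sim> b \<Longrightarrow> c \<sim> d \<Longrightarrow> a + c \<sim> b + d"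
  by (simp add: eqv_def distrib_right X_add)

lemma eqv_mult: "a \<sim> b \<Longrightarrow> c \<sim> d \<Longrightarrow> a * c \<sim> b * d"
  unfolding eqv_def by (metis mult.assoc mult.commute)

lemma eqv_power: "a \<sim> b \<Longrightarrow> a ^ k \<sim> b ^ k"
  by (induction k) (simp_all add: eqv_mult)

text \<open>The quotient by the ideal is torsion-free because \<open>X\<close> takes integer values.
  This is what lets the descent divide by a prime.\<close>

lemma eqv_cancel_of_int: "of_int c * a \<sim> of_int c * b \<Longrightarrow> c \<noteq> 0 \<Longrightarrow> a \<sim> b"
  by (simp add: eqv_def mult.assoc X_of_int)

lemma radical_eqv: "t i ^ n \<sim> of_int (D i)"
  by (simp add: eqv_def X_radical X_of_int)

section \<open>The ring spanned by the first radicals, and congruence modulo a prime in it\<close>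

inductive_set span_ring :: "nat \<Rightarrow> 'a set" for s :: nat where
  span_ring_of_int [intro]: "of_int c \<in> span_ring s"
| span_ring_gen [intro]: "i < s \<Longrightarrow> t i \<in> span_ring s"
| span_ring_add [intro]: "a \<in> span_ring s \<Longrightarrow> b \<in> span_ring s \<Longrightarrow> a + b \<in> span_ring s"
| span_ring_mult [intro]: "a \<in> span_ring s \<Longrightarrow> b \<in> span_ring s \<Longrightarrow> a * b \<in> span_ring s"

lemma span_ring_zero [intro]: "0 \<in> span_ring s"
  using span_ring_of_int[of 0 s] by simp

lemma span_ring_one [intro]: "1 \<in> span_ring s"
  using span_ring_of_int[of 1 s] by simp

lemma span_ring_of_nat [intro]: "of_nat k \<in> span_ring s"
  using span_ring_of_int[of "int k" s] by simp

lemma span_ring_minus [intro]: "a \<in> span_ring s \<Longrightarrow> - a \<in> span_ring s"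
  using span_ring_mult[OF span_ring_of_int[of "-1" s], of a] by simp

lemma span_ring_power [intro]: "a \<in> span_ring s \<Longrightarrow> a ^ k \<in> span_ring s"
  by (induction k) auto

lemma span_ring_sum: "(\<And>i. i \<in> A \<Longrightarrow> f i \<in> span_ring s) \<Longrightarrow> (\<Sum>i\<in>A. f i) \<in> span_ring s"
  by (induction A rule: infinite_finite_induct) auto

lemma span_ring_prod: "(\<And>i. i \<in> A \<Longrightarrow> f i \<in> span_ring s) \<Longrightarrow> (\<Prod>i\<in>A. f i) \<in> span_ring s"
  by (induction A rule: infinite_finite_induct) auto

text \<open>The cofactor \<open>z\<close> must stay in \<open>span_ring s\<close>, the ring of the
  first \<open>s\<close> radicals. When the prime attached to \<open>t s\<close> is treated, only
  radicals with \<open>D i\<close> prime to it occur, and the cofactors can be fed back into the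
  descent.\<close>

definition eqv_mod :: "nat \<Rightarrow> int \<Rightarrow> 'a \<Rightarrow> 'a \<Rightarrow> bool" where
  "eqv_mod s l a b \<longleftrightarrow> (\<exists>z\<in>span_ring s. a \<sim> b + of_int l * z)"

lemma eqv_mod_of_eqv: "a \<sim> b \<Longrightarrow> eqv_mod s l a b"
  unfolding eqv_mod_def by (intro bexI[of _ 0]) auto

lemma eqv_mod_refl [simp]: "eqv_mod s l a a"
  by (simp add: eqv_mod_of_eqv)

lemma eqv_mod_trans [trans]:
  assumes "eqv_mod s l a b" "eqv_mod s l b c"
  shows "eqv_mod s l a c"
proof -
  obtain y z where y: "y \<in> span_ring s" "a \<sim> b + of_int l * y"
    and z: "z \<in> span_ring s" "b \<sim> c + of_int l * z"
    using assms by (auto simp: eqv_mod_def)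
  have "a \<sim> c + of_int l * z + of_int l * y"
    using eqv_trans[OF y(2) eqv_add[OF z(2) eqv_refl]] .
  then have "a \<sim> c + of_int l * (z + y)"
    by (simp add: algebra_simps)
  with y z show ?thesis unfolding eqv_mod_def by blast
qed

lemma eqv_mod_add:
  assumes "eqv_mod s l a b" "eqv_mod s l c d"
  shows "eqv_mod s l (a + c) (b + d)"
proof -
  obtain y z where y: "y \<in> span_ring s" "a \<sim> b + of_int l * y"
    and z: "z \<in> span_ring s" "c \<sim> d + of_int l * z"
    using assms by (auto simp: eqv_mod_def)
  have "a + c \<sim> b + d + of_int l * (y + z)"
    using eqv_add[OF y(2) z(2)] by (simp add: algebra_simps)
  with y z show ?thesis unfolding eqv_mod_def by blast
qed

lemma eqv_mod_mult:
  assumes "eqv_mod s l a b" "eqv_mod s l c d" "b \<in> span_ring s" "d \<in> span_ring s"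
  shows "eqv_mod s l (a * c) (b * d)"
proof -
  obtain y z where y: "y \<in> span_ring s" "a \<sim> b + of_int l * y"
    and z: "z \<in> span_ring s" "c \<sim> d + of_int l * z"
    using assms by (auto simp: eqv_mod_def)
  have "a * c \<sim> b * d + of_int l * (b * z + y * d + of_int l * y * z)"
    using eqv_mult[OF y(2) z(2)] by (simp add: algebra_simps)
  moreover have "b * z + y * d + of_int l * y * z \<in> span_ring s"
    using assms y z by auto
  ultimately show ?thesis unfolding eqv_mod_def by blast
qed

lemma eqv_mod_power:
  assumes "eqv_mod s l a b" "b \<in> span_ring s"
  shows "eqv_mod s l (a ^ k) (b ^ k)"
  using assms by (induction k) (auto intro!: eqv_mod_mult)

lemma eqv_mod_of_int:
  assumes "[c = d] (mod l)"
  shows "eqv_mod s l (of_int c) (of_int d)"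
proof -
  obtain k where "c = d + l * k"
    using assms by (metis cong_iff_lin cong_sym)
  then have "(of_int c :: 'a) \<sim> of_int d + of_int l * of_int k"
    by simp
  then show ?thesis unfolding eqv_mod_def by blast
qed

lemma eqv_mod_freshman:
  assumes l: "prime (l::nat)" and ab: "a \<in> span_ring s" "b \<in> span_ring s"
  shows "eqv_mod s (int l) ((a + b) ^ l) (a ^ l + b ^ l)"
proof -
  define z where "z = (\<Sum>k\<in>{0<..<l}. of_nat ((l choose k) div l) * a ^ k * b ^ (l - k))"
  have l0: "l > 0" using l prime_gt_0_nat by blast
  have "(a + b) ^ l = (\<Sum>k\<le>l. of_nat (l choose k) * a ^ k * b ^ (l - k))"
    by (rule binomial_ring)
  also have "{..l} = insert 0 (insert l {0<..<l})"
    using l0 by auto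
  also have "(\<Sum>k\<in>\<dots>. of_nat (l choose k) * a ^ k * b ^ (l - k)) =
      b ^ l + (a ^ l + (\<Sum>k\<in>{0<..<l}. of_nat (l choose k) * a ^ k * b ^ (l - k)))"
    using l0 by simp
  also have "(\<Sum>k\<in>{0<..<l}. of_nat (l choose k) * a ^ k * b ^ (l - k)) = of_nat l * z"
    unfolding z_def sum_distrib_left
  proof (rule sum.cong)
    fix k assume "k \<in> {0<..<l}"
    then have "l dvd (l choose k)" using l by (intro dvd_choose_prime) auto
    then have "(of_nat (l choose k) :: 'a) = of_nat l * of_nat ((l choose k) div l)"
      by (metis dvd_mult_div_cancel of_nat_mult)
    then show "of_nat (l choose k) * a ^ k * b ^ (l - k) =
        of_nat l * (of_nat ((l choose k) div l) * a ^ k * b ^ (l - k))"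
      by (simp add: mult.assoc)
  qed simp
  finally have "(a + b) ^ l = a ^ l + b ^ l + of_int (int l) * z"
    by (simp add: add_ac)
  moreover have "z \<in> span_ring s"
    unfolding z_def using ab by (intro span_ring_sum span_ring_mult) auto
  ultimately show ?thesis unfolding eqv_mod_def by (metis eqv_refl)
qed

lemma eqv_mod_freshman_iterated:
  assumes l: "prime (l::nat)" and ab: "a \<in> span_ring s" "b \<in> span_ring s"
  shows "eqv_mod s (int l) ((a + b) ^ l ^ k) (a ^ l ^ k + b ^ l ^ k)"
proof (induction k)
  case (Suc k)
  have "eqv_mod s (int l) (((a + b) ^ l ^ k) ^ l) ((a ^ l ^ k + b ^ l ^ k) ^ l)"
    using Suc ab by (intro eqv_mod_power) auto
  also have "eqv_mod s (int l) \<dots> ((a ^ l ^ k) ^ l + (b ^ l ^ k) ^ l)"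
    using l ab by (intro eqv_mod_freshman) auto
  finally show ?case by (simp add: power_mult[symmetric] mult.commute)
qed simp

text \<open>
  Modulo a prime that divides neither the exponent nor any \<open>D i\<close>, the ring generated by the
  radicals is a quotient of a product of finite fields, so some power of Frobenius is the identity.
\<close>
lemma frobenius_power_trivial:
  assumes l: "prime (l::nat)" and ln: "\<not> l dvd n" and lD: "\<And>i. i < s \<Longrightarrow> \<not> int l dvd D i"
  obtains N where "N \<ge> n" "\<And>a. a \<in> span_ring s \<Longrightarrow> eqv_mod s (int l) (a ^ N) a"
proof -
  have n0: "n > 0" using ln by (cases n) auto
  have l2: "l \<ge> 2" using l prime_ge_2_nat by blast
  \<comment> \<open>By Euler, \<open>l ^ k\<close> is 1 modulo \<open>n * (l - 1)\<close>. So
    \<open>N = 1 + n * (l - 1) * m\<close> and \<open>t i ^ N\<close> is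
    \<open>t i * D i ^ ((l - 1) * m)\<close>, which Fermat reduces to \<open>t i\<close>. The extra
    factor \<open>n\<close> in \<open>k\<close> guarantees \<open>N \<ge> n\<close>.\<close>
  define k where "k = n * totient (n * (l - 1))"
  define N where "N = l ^ k"
  have cop1: "coprime l (l - 1)"
    by (metis One_nat_def Suc_pred coprime_Suc_left_nat l prime_gt_0_nat)
  have "coprime l n" using l ln prime_imp_coprime by blast
  then have "coprime l (n * (l - 1))" using cop1 by simp
  then have "[l ^ totient (n * (l - 1)) = 1] (mod (n * (l - 1)))"
    by (rule euler_theorem)
  then have "[(l ^ totient (n * (l - 1))) ^ n = 1 ^ n] (mod (n * (l - 1)))"
    by (rule cong_pow)
  then have N1: "[N = 1] (mod (n * (l - 1)))"
    by (simp add: N_def k_def power_mult[symmetric] mult.commute)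
  have "N \<ge> 1" using l2 by (simp add: N_def)
  then obtain m where m: "N = 1 + n * (l - 1) * m"
    using N1 by (metis cong_to_1_nat dvdE le_add_diff_inverse)
  have tot: "totient (n * (l - 1)) \<ge> 1"
    using n0 l2 by (simp add: Suc_leI)
  then have "k \<ge> n" by (simp add: k_def)
  have "k < l ^ k" using l2 by (simp add: power_gt_expt)
  with \<open>k \<ge> n\<close> have "N \<ge> n" by (simp add: N_def)
  moreover have "eqv_mod s (int l) (a ^ N) a" if "a \<in> span_ring s" for a
    using that
  proof induction
    case (span_ring_of_int c)
    have fermat: "[c ^ l = c] (mod int l)" for c :: int
    proof (cases "int l dvd c")
      case True
      then show ?thesis using l
        by (metis cong_0_iff cong_sym cong_trans dvd_power prime_gt_0_nat dvd_trans)
    next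
      case False
      then have "[c ^ (l - 1) = 1] (mod int l)"
        using l by (intro fermat_theorem_int)
      then have "[c * c ^ (l - 1) = c * 1] (mod int l)"
        by (rule cong_scalar_left)
      then show ?thesis using l2 by (simp flip: power_Suc)
    qed
    have "[c ^ l ^ j = c] (mod int l)" for j
    proof (induction j)
      case (Suc j)
      have "[(c ^ l ^ j) ^ l = c ^ l] (mod int l)"
        using Suc by (rule cong_pow)
      then show ?case using fermat[of c]
        by (metis cong_trans power_Suc2 power_mult)
    qed simp
    from eqv_mod_of_int[OF this] show ?case unfolding N_def
      by (metis of_int_power)
  next
    case (span_ring_gen i)
    have "[D i ^ (l - 1) = 1] (mod int l)"
      using l lD[OF span_ring_gen] by (intro fermat_theorem_int)
    from cong_pow[OF this, of m] have "[D i ^ ((l - 1) * m) = 1] (mod int l)"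
      by (simp add: power_mult)
    from eqv_mod_of_int[OF this]
    have one: "eqv_mod s (int l) (of_int (D i) ^ ((l - 1) * m)) 1"
      by simp
    have "t i ^ N = t i * (t i ^ n) ^ ((l - 1) * m)"
      by (simp add: m power_mult[symmetric] mult.assoc)
    also have "\<dots> \<sim> t i * of_int (D i) ^ ((l - 1) * m)"
      by (intro eqv_mult eqv_power radical_eqv eqv_refl)
    finally have "eqv_mod s (int l) (t i ^ N) (t i * of_int (D i) ^ ((l - 1) * m))"
      by (rule eqv_mod_of_eqv)
    also have "eqv_mod s (int l) \<dots> (t i * 1)"
      using one span_ring_gen by (intro eqv_mod_mult) auto
    finally show ?case by simp
  next
    case (span_ring_add a b)
    have "eqv_mod s (int l) ((a + b) ^ N) (a ^ N + b ^ N)"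
      unfolding N_def using l span_ring_add by (intro eqv_mod_freshman_iterated) auto
    also have "eqv_mod s (int l) \<dots> (a + b)"
      using span_ring_add by (intro eqv_mod_add) auto
    finally show ?case .
  next
    case (span_ring_mult a b)
    then show ?case by (auto simp: power_mult_distrib intro: eqv_mod_mult)
  qed
  ultimately show ?thesis using that by blast
qed

text \<open>The ring modulo \<open>l\<close> has no nilpotents: if \<open>l\<close> divides
  \<open>a ^ n\<close>, it divides \<open>a ^ N\<close> because \<open>N \<ge> n\<close>, and
  \<open>a ^ N\<close> is \<open>a\<close> modulo \<open>l\<close>.\<close>

lemma reduced_mod_prime:
  assumes l: "prime (l::nat)" and ln: "\<not> l dvd n" and lD: "\<And>i. i < s \<Longrightarrow> \<not> int l dvd D i"
    and a: "a \<in> span_ring s" and z: "z \<in> span_ring s" "a ^ n \<sim> of_int (int l) * z"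
  obtains b where "b \<in> span_ring s" "a \<sim> of_int (int l) * b"
proof -
  obtain N where N: "N \<ge> n" "eqv_mod s (int l) (a ^ N) a"
    using frobenius_power_trivial[OF l ln lD] a by metis
  then obtain y where y: "y \<in> span_ring s" "a ^ N \<sim> a + of_int (int l) * y"
    by (auto simp: eqv_mod_def)
  have "a \<sim> a ^ N + - (of_int (int l) * y)"
    using eqv_add[OF eqv_sym[OF y(2)] eqv_refl[of "- (of_int (int l) * y)"]] by simp
  also have "a ^ N = a ^ n * a ^ (N - n)"
    using N by (simp flip: power_add)
  also have "a ^ n * a ^ (N - n) + - (of_int (int l) * y) \<sim>
      of_int (int l) * z * a ^ (N - n) + - (of_int (int l) * y)"
    by (intro eqv_add eqv_mult z eqv_refl)
  also have "\<dots> = of_int (int l) * (z * a ^ (N - n) + - y)"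
    by (simp add: algebra_simps)
  finally show ?thesis
    by (rule that[rotated]) (intro span_ring_add span_ring_mult span_ring_power span_ring_minus a y z)
qed

text \<open>This copies the proof that an \<open>n\<close>-th root of \<open>l * d\<close> is
  irrational. The prime \<open>l\<close> divides \<open>a ^ n\<close>, hence \<open>a\<close>.
  Cancelling one \<open>l\<close> leaves \<open>l ^ (n - 1) * a' ^ n = d * b ^ n\<close>. As
  \<open>n \<ge> 2\<close> and \<open>d\<close> is invertible modulo \<open>l\<close>,
  \<open>l\<close> divides \<open>b ^ n\<close> and hence \<open>b\<close>, and the same equation
  returns for the quotients.\<close>

lemma radical_descent_step:
  assumes l: "prime (l::nat)" and ln: "\<not> l dvd n" and lD: "\<And>i. i < s \<Longrightarrow> \<not> int l dvd D i"
    and n2: "n \<ge> 2" and d: "\<not> int l dvd d"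
    and a: "a \<in> span_ring s" and b: "b \<in> span_ring s"
    and eq: "a ^ n \<sim> of_int (int l * d) * b ^ n"
  obtains a' b' where "a' \<in> span_ring s" "b' \<in> span_ring s"
    "a \<sim> of_int (int l) * a'" "b \<sim> of_int (int l) * b'"
    "a' ^ n \<sim> of_int (int l * d) * b' ^ n"
proof -
  have l0: "int l \<noteq> 0" using l prime_gt_0_nat by fastforce
  obtain m where m: "n = Suc (Suc m)"
    using n2 by (metis One_nat_def Suc_le_D Suc_le_mono numeral_2_eq_2)
  obtain a' where a': "a' \<in> span_ring s" "a \<sim> of_int (int l) * a'"
  proof (rule reduced_mod_prime[OF l ln lD a])
    show "a ^ n \<sim> of_int (int l) * (of_int d * b ^ n)"
      using eq by (simp add: mult.assoc)
  qed (use b in auto)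
  have "of_int (int l) * (of_int (int l ^ (n - 1)) * a' ^ n) = (of_int (int l) * a') ^ n"
    by (simp add: m power_mult_distrib algebra_simps)
  also have "\<dots> \<sim> a ^ n"
    by (intro eqv_power eqv_sym[OF a'(2)])
  also have "\<dots> \<sim> of_int (int l * d) * b ^ n" by (rule eq)
  also have "\<dots> = of_int (int l) * (of_int d * b ^ n)"
    by (simp add: mult.assoc)
  finally have e1: "of_int (int l ^ (n - 1)) * a' ^ n \<sim> of_int d * b ^ n"
    by (rule eqv_cancel_of_int) (rule l0)
  have "coprime (int l) d" using l d
    by (meson prime_imp_coprime prime_nat_int_transfer)
  then obtain u v where uv: "u * int l + v * d = 1"
    by (metis bezout_int coprime_imp_gcd_eq_1)
  have "b ^ n = of_int (u * int l) * b ^ n + of_int v * (of_int d * b ^ n)"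
  proof -
    have "of_int (u * int l + v * d) * b ^ n = b ^ n" by (simp only: uv of_int_1 mult_1_left)
    then show ?thesis by (simp add: distrib_right mult.assoc)
  qed
  also have "\<dots> \<sim> of_int (u * int l) * b ^ n + of_int v * (of_int (int l ^ (n - 1)) * a' ^ n)"
    by (intro eqv_add eqv_mult eqv_refl eqv_sym[OF e1])
  also have "\<dots> = of_int (int l) * (of_int u * b ^ n + of_int v * of_int (int l ^ (n - 2)) * a' ^ n)"
    by (simp add: m algebra_simps)
  finally have e2: "b ^ n \<sim> of_int (int l) * (of_int u * b ^ n + of_int v * of_int (int l ^ (n - 2)) * a' ^ n)" .
  obtain b' where b': "b' \<in> span_ring s" "b \<sim> of_int (int l) * b'"
    by (rule reduced_mod_prime[OF l ln lD b _ e2])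
      (auto intro!: span_ring_add span_ring_mult span_ring_power a' b simp del: of_int_power)
  have "of_int (int l ^ (n - 1)) * a' ^ n \<sim> of_int d * (of_int (int l) * b') ^ n"
    using e1 eqv_mult[OF eqv_refl eqv_power[OF b'(2)]] by (rule eqv_trans)
  also have "\<dots> = of_int (int l ^ (n - 1)) * (of_int (int l * d) * b' ^ n)"
    by (simp add: m power_mult_distrib algebra_simps)
  finally have "a' ^ n \<sim> of_int (int l * d) * b' ^ n"
    by (rule eqv_cancel_of_int) (use l0 in simp)
  with that a' b' show ?thesis by blast
qed

text \<open>The step can be iterated forever, so every value \<open>X (a * g)\<close> and
  \<open>X (b * g)\<close> is an integer divisible by all powers of \<open>l\<close>, that is,
  zero.\<close>

lemma radical_descent:
  assumes l: "prime (l::nat)" and ln: "\<not> l dvd n" and lD: "\<And>i. i < s \<Longrightarrow> \<not> int l dvd D i"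
    and n2: "n \<ge> 2" and d: "\<not> int l dvd d"
    and a: "a \<in> span_ring s" and b: "b \<in> span_ring s"
    and eq: "a ^ n \<sim> of_int (int l * d) * b ^ n"
  shows "a \<sim> 0" "b \<sim> 0"
proof -
  have step: "\<exists>a' b'. a \<sim> of_int (int l ^ k) * a' \<and> b \<sim> of_int (int l ^ k) * b'" for k
    using a b eq
  proof (induction k arbitrary: a b)
    case 0
    show ?case by (intro exI[of _ a] exI[of _ b]) simp
  next
    case (Suc k)
    obtain a1 b1 where 1: "a1 \<in> span_ring s" "b1 \<in> span_ring s"
      "a \<sim> of_int (int l) * a1" "b \<sim> of_int (int l) * b1"
      "a1 ^ n \<sim> of_int (int l * d) * b1 ^ n"
      using radical_descent_step[OF l ln lD n2 d Suc.prems] by metis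
    obtain a2 b2 where 2: "a1 \<sim> of_int (int l ^ k) * a2" "b1 \<sim> of_int (int l ^ k) * b2"
      using Suc.IH[OF 1(1,2,5)] by blast
    have "a \<sim> of_int (int l) * (of_int (int l ^ k) * a2)"
      "b \<sim> of_int (int l) * (of_int (int l ^ k) * b2)"
      using 1(3,4) 2 by (meson eqv_mult eqv_refl eqv_trans)+
    then show ?case by (auto simp: mult.assoc)
  qed
  have l2: "int l > 1" using l prime_gt_1_nat by simp
  have zero: "x = 0" if "\<And>k. int l ^ k dvd x" for x :: int
  proof (rule ccontr)
    assume "x \<noteq> 0"
    then have "finite {k. int l ^ k dvd x}"
      using l2 finite_divisor_powers[of x "int l"] by auto
    then show False using that by simp
  qed
  have "X (a * g) = 0" "X (b * g) = 0" for g
  proof -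
    show "X (a * g) = 0"
    proof (rule zero)
      fix k
      obtain a' where "a \<sim> of_int (int l ^ k) * a'" using step by blast
      then have "X (a * g) = int l ^ k * X (a' * g)"
        by (simp add: eqv_def mult.assoc X_of_int del: of_int_power)
      then show "int l ^ k dvd X (a * g)" by simp
    qed
    show "X (b * g) = 0"
    proof (rule zero)
      fix k
      obtain b' where "b \<sim> of_int (int l ^ k) * b'" using step by blast
      then have "X (b * g) = int l ^ k * X (b' * g)"
        by (simp add: eqv_def mult.assoc X_of_int del: of_int_power)
      then show "int l ^ k dvd X (b * g)" by simp
    qed
  qed
  then show "a \<sim> 0" "b \<sim> 0" by (simp_all add: eqv_def)
qed

text \<open>Sorting a relation by the last radical gives \<open>a + t r * b \<sim> 0\<close>, and
  the \<open>n\<close>-th power gives \<open>a ^ n \<sim> (-1) ^ n * D r * b ^ n\<close>. Since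
  \<open>l r\<close> divides \<open>D r\<close> exactly once and divides no earlier
  \<open>D i\<close>, the descent at \<open>l r\<close> kills both \<open>a\<close> and
  \<open>b\<close>, which are relations in fewer radicals. The base case needs \<open>X\<close> to
  be nonzero somewhere.\<close>

lemma squarefree_monomials_independent:
  assumes n2: "n \<ge> 2" and nontrivial: "X g \<noteq> 0"
    and l: "\<And>i. i < r \<Longrightarrow> prime (l i :: nat)" and ln: "\<And>i. i < r \<Longrightarrow> \<not> l i dvd n"
    and D: "\<And>i. i < r \<Longrightarrow> D i = int (l i) * d i"
    and d: "\<And>i. i < r \<Longrightarrow> \<not> int (l i) dvd d i"
    and lD: "\<And>i j. i < j \<Longrightarrow> j < r \<Longrightarrow> \<not> int (l j) dvd D i"
    and c: "(\<Sum>S\<in>Pow {..<r}. of_int (c S) * (\<Prod>i\<in>S. t i)) \<sim> 0"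
    and S: "S \<subseteq> {..<r}"
  shows "c S = 0"
  using l ln D d lD c S
proof (induction r arbitrary: c S)
  case 0
  then have "X (of_int (c {}) * g) = 0" by (simp add: eqv_def)
  then show ?case using nontrivial 0 by (simp add: X_of_int)
next
  case (Suc r)
  define a where "a = (\<Sum>S\<in>Pow {..<r}. of_int (c S) * (\<Prod>i\<in>S. t i))"
  define b where "b = (\<Sum>S\<in>Pow {..<r}. of_int (c (insert r S)) * (\<Prod>i\<in>S. t i))"
  have ab: "a \<in> span_ring r" "b \<in> span_ring r"
    unfolding a_def b_def by (intro span_ring_sum span_ring_mult span_ring_of_int span_ring_prod span_ring_gen; auto)+
  have "(\<Sum>S\<in>Pow {..<Suc r}. of_int (c S) * (\<Prod>i\<in>S. t i)) =
      (\<Sum>S\<in>Pow {..<r} \<union> insert r ` Pow {..<r}. of_int (c S) * (\<Prod>i\<in>S. t i))"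
    by (simp add: lessThan_Suc Pow_insert)
  also have "\<dots> = a + (\<Sum>S\<in>insert r ` Pow {..<r}. of_int (c S) * (\<Prod>i\<in>S. t i))"
    unfolding a_def by (intro sum.union_disjoint) auto
  also have "(\<Sum>S\<in>insert r ` Pow {..<r}. of_int (c S) * (\<Prod>i\<in>S. t i)) =
      (\<Sum>S\<in>Pow {..<r}. of_int (c (insert r S)) * (\<Prod>i\<in>insert r S. t i))"
    by (intro sum.reindex_cong[where l = "insert r"])
      (auto simp: inj_on_def insert_eq_iff intro: insert_ident[THEN iffD1])
  also have "\<dots> = t r * b"
    unfolding b_def sum_distrib_left
  proof (rule sum.cong)
    fix S assume "S \<in> Pow {..<r}"
    then have "finite S" "r \<notin> S" by (auto intro: finite_subset)
    then show "of_int (c (insert r S)) * (\<Prod>i\<in>insert r S. t i) =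
        t r * (of_int (c (insert r S)) * (\<Prod>i\<in>S. t i))"
      by (simp add: algebra_simps)
  qed simp
  finally have "a + t r * b \<sim> 0" using Suc.prems(6) by simp
  from eqv_add[OF this eqv_refl[of "- (t r * b)"]] have "a \<sim> - t r * b" by simp
  from eqv_power[OF this, of n] have "a ^ n \<sim> (- 1) ^ n * t r ^ n * b ^ n"
    by (simp flip: power_mult_distrib)
  also have "\<dots> \<sim> (- 1) ^ n * of_int (D r) * b ^ n"
    by (intro eqv_mult eqv_refl radical_eqv)
  also have "\<dots> = of_int (int (l r) * ((- 1) ^ n * d r)) * b ^ n"
    using Suc.prems(3)[of r] by (simp add: algebra_simps)
  finally have eq: "a ^ n \<sim> of_int (int (l r) * ((- 1) ^ n * d r)) * b ^ n" .
  have lr: "prime (l r)" "\<not> l r dvd n" using Suc.prems(1,2) by auto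
  have dr: "\<not> int (l r) dvd (- 1) ^ n * d r"
    using Suc.prems(4)[of r] by (cases "even n") auto
  have "a \<sim> 0" "b \<sim> 0"
    by (rule radical_descent[OF lr _ n2 dr ab eq]; use Suc.prems(5) in auto)+
  then have zero: "c S = 0" "c (insert r S) = 0" if "S \<subseteq> {..<r}" for S
    using Suc.IH[of c S] Suc.IH[of "\<lambda>S. c (insert r S)" S] Suc.prems(1-5) that
    unfolding a_def b_def by auto
  show ?case
  proof (cases "r \<in> S")
    case True
    have "S - {r} \<subseteq> {..<r}" using Suc.prems(7) by auto
    from zero(2)[OF this] True show ?thesis by (simp add: insert_absorb)
  next
    case False
    then have "S \<subseteq> {..<r}" using Suc.prems(7) by (auto simp: less_Suc_eq)
    then show ?thesis by (rule zero(1))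
  qed
qed

end

section \<open>Residues of products of radicals\<close>

definition linear_ext :: "('e \<Rightarrow> int) \<Rightarrow> ('e \<Rightarrow>\<^sub>0 int) \<Rightarrow> int" where
  "linear_ext x p = (\<Sum>e\<in>Poly_Mapping.keys p. Poly_Mapping.lookup p e * x e)"

lemma linear_ext_superset:
  assumes "finite F" "Poly_Mapping.keys p \<subseteq> F"
  shows "linear_ext x p = (\<Sum>e\<in>F. Poly_Mapping.lookup p e * x e)"
  unfolding linear_ext_def using assms
  by (intro sum.mono_neutral_left) (auto simp: in_keys_iff)

lemma linear_ext_add: "linear_ext x (p + q) = linear_ext x p + linear_ext x q"
proof -
  have "Poly_Mapping.keys (p + q) \<subseteq> Poly_Mapping.keys p \<union> Poly_Mapping.keys q" by (rule keys_add)
  then show ?thesis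
    by (simp add: linear_ext_superset[of "Poly_Mapping.keys p \<union> Poly_Mapping.keys q"] lookup_add distrib_right sum.distrib)
qed

lemma linear_ext_single [simp]: "linear_ext x (Poly_Mapping.single e c) = c * x e"
  by (simp add: linear_ext_def)

lemma linear_ext_sum: "linear_ext x (\<Sum>i\<in>A. f i) = (\<Sum>i\<in>A. linear_ext x (f i))"
  by (induction A rule: infinite_finite_induct) (simp_all add: linear_ext_add, simp_all add: linear_ext_def)

lemma poly_mapping_eq_sum_single: "p = (\<Sum>e\<in>Poly_Mapping.keys p. Poly_Mapping.single e (Poly_Mapping.lookup p e))"
  by (rule poly_mapping_eqI) (auto simp: lookup_sum lookup_single when_def in_keys_iff sum.delta' cong: if_cong)

lemma linear_ext_single_mult:
  fixes e :: "'e :: comm_monoid_add"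
  shows "linear_ext x (Poly_Mapping.single e c * g) = (\<Sum>f\<in>Poly_Mapping.keys g. Poly_Mapping.lookup g f * (c * x (e + f)))"
proof -
  have "Poly_Mapping.single e c * g = (\<Sum>f\<in>Poly_Mapping.keys g. Poly_Mapping.single (e + f) (c * Poly_Mapping.lookup g f))"
    by (subst (1) poly_mapping_eq_sum_single[of g]) (simp add: sum_distrib_left mult_single)
  then show ?thesis by (simp add: linear_ext_sum mult_ac)
qed

text \<open>Exponent vectors are arbitrary functions under pointwise addition, and
  \<open>mono_var i\<close> is the \<open>i\<close>-th formal radical in the resulting monoid ring.
  A functional is thus just an integer function of exponent vectors.\<close>

definition mono_var :: "nat \<Rightarrow> (nat \<Rightarrow> nat) \<Rightarrow>\<^sub>0 int" where
  "mono_var i = Poly_Mapping.single (\<lambda>j. if j = i then 1 else 0) 1"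

lemma mono_var_power: "mono_var i ^ k = Poly_Mapping.single (\<lambda>j. if j = i then k else 0) 1"
proof (induction k)
  case 0
  have "(\<lambda>j. if j = i then 0 else 0) = (0 :: nat \<Rightarrow> nat)" by auto
  then show ?case by simp
next
  case (Suc k)
  have "(\<lambda>j. if j = i then 1 else 0) + (\<lambda>j. if j = i then k else 0) =
      (\<lambda>j. if j = i then Suc k else (0::nat))"
    by auto
  then show ?case using Suc by (simp add: mono_var_def mult_single)
qed

lemma mono_var_prod:
  assumes "finite S"
  shows "(\<Prod>i\<in>S. mono_var i) = Poly_Mapping.single (\<lambda>j. if j \<in> S then 1 else 0) 1"
  using assms
proof induction
  case empty
  have "(\<lambda>j. if j \<in> {} then 1 else 0) = (0 :: nat \<Rightarrow> nat)" by auto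
  then show ?case by simp
next
  case (insert i S)
  have "(\<lambda>j. if j = i then 1 else 0) + (\<lambda>j. if j \<in> S then 1 else 0) =
      (\<lambda>j. if j \<in> insert i S then 1 else (0::nat))"
    using insert by auto
  then show ?case using insert by (simp add: mono_var_def mult_single)
qed

text \<open>Pigeonhole: there are more coefficient vectors with entries in \<open>{0..B}\<close>
  than residues modulo \<open>Q\<close>. The difference of two vectors with the same residue is the
  relation.\<close>

lemma small_linear_relation:
  fixes \<kappa> :: "'i \<Rightarrow> int"
  assumes "finite I" "(B + 1) ^ card I > Q" "Q > (0::nat)"
  obtains c :: "'i \<Rightarrow> int" and i where "i \<in> I" "c i \<noteq> 0" "\<And>i. i \<in> I \<Longrightarrow> \<bar>c i\<bar> \<le> int B"
    "[(\<Sum>i\<in>I. c i * \<kappa> i) = 0] (mod int Q)"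
proof -
  define F where "F = (I \<rightarrow>\<^sub>E {0..B})"
  define \<phi> where "\<phi> c = (\<Sum>i\<in>I. int (c i) * \<kappa> i) mod int Q" for c
  have "\<phi> ` F \<subseteq> {0..<int Q}" using assms by (auto simp: \<phi>_def)
  then have "card (\<phi> ` F) \<le> Q" using card_mono[of "{0..<int Q}"] by force
  moreover have "card F = (B + 1) ^ card I" using assms by (simp add: F_def card_PiE)
  ultimately have "\<not> inj_on \<phi> F" using assms by (intro pigeonhole) simp
  then obtain a b where ab: "a \<in> F" "b \<in> F" "a \<noteq> b" "\<phi> a = \<phi> b"
    by (auto simp: inj_on_def)
  then obtain i where i: "i \<in> I" "a i \<noteq> b i"
    unfolding F_def by (metis PiE_ext)
  have "[(\<Sum>i\<in>I. int (a i) * \<kappa> i) - (\<Sum>i\<in>I. int (b i) * \<kappa> i) = 0] (mod int Q)"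
    using ab(4) by (simp add: cong_diff_iff_cong_0) (simp add: \<phi>_def cong_def)
  then have "[(\<Sum>i\<in>I. (int (a i) - int (b i)) * \<kappa> i) = 0] (mod int Q)"
    by (simp add: left_diff_distrib sum_subtractf)
  moreover have "\<bar>int (a j) - int (b j)\<bar> \<le> int B" if "j \<in> I" for j
  proof -
    have "a j \<le> B" "b j \<le> B" using ab that by (auto simp: F_def)
    then show ?thesis by linarith
  qed
  ultimately show ?thesis using that[of i "\<lambda>i. int (a i) - int (b i)"] i by auto
qed

text \<open>The hypothesis on \<open>Z\<close> is what a contradiction costs: a relation has
  \<open>2 ^ r\<close> terms, its coefficients are at most \<open>Q powr (1 / 2 ^ r)\<close>,
  reducing the exponents below \<open>n\<close> contributes at most \<open>M ^ r\<close>, and each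
  representative is assumed smaller than \<open>Z\<close>. A multiple of \<open>Q\<close> of this
  size is zero.\<close>

lemma radical_residue_large:
  fixes Q n r :: nat and l :: "nat \<Rightarrow> nat" and D d \<kappa> :: "nat \<Rightarrow> int" and M Z :: real
  assumes n2: "n \<ge> 2" and nQ: "n < Q"
    and l: "\<And>i. i < r \<Longrightarrow> prime (l i)" and ln: "\<And>i. i < r \<Longrightarrow> \<not> l i dvd n"
    and D: "\<And>i. i < r \<Longrightarrow> D i = int (l i) * d i"
    and d: "\<And>i. i < r \<Longrightarrow> \<not> int (l i) dvd d i"
    and lD: "\<And>i j. i < j \<Longrightarrow> j < r \<Longrightarrow> \<not> int (l j) dvd D i"
    and DM: "\<And>i. i < r \<Longrightarrow> 1 \<le> D i \<and> D i \<le> M"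
    and \<kappa>: "\<And>i. i < r \<Longrightarrow> [\<kappa> i ^ n = D i] (mod int Q)"
    and M: "M \<ge> 1"
    and Z: "2 ^ r * real Q powr (1 / 2 ^ r) * M ^ r * Z < real Q"
  obtains e where "\<And>i. e i < n"
    "\<And>z. [z = int n * (\<Prod>i<r. \<kappa> i ^ e i)] (mod int Q) \<Longrightarrow> Z \<le> \<bar>real_of_int z\<bar>"
proof (rule ccontr)
  assume "\<not> thesis"
  then have "\<forall>e. (\<forall>i. e i < n) \<longrightarrow> (\<exists>z. [z = int n * (\<Prod>i<r. \<kappa> i ^ e i)] (mod int Q) \<and> \<bar>real_of_int z\<bar> < Z)"
    using that by (meson not_le)
  then obtain z where z: "\<And>e. (\<And>i. e i < n) \<Longrightarrow> [z e = int n * (\<Prod>i<r. \<kappa> i ^ e i)] (mod int Q)"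
    and zZ: "\<And>e. (\<And>i. e i < n) \<Longrightarrow> \<bar>real_of_int (z e)\<bar> < Z"
    by metis
  \<comment> \<open>Exponents are reduced modulo \<open>n\<close>, and each carry of
    \<open>n\<close> in place \<open>i\<close> is paid by a factor \<open>D i\<close>. The radical
    law then holds exactly over the integers, while \<open>x e\<close> stays in the right residue
    class because \<open>\<kappa> i ^ n\<close> is congruent to \<open>D i\<close>.\<close>
  define x where "x e = (\<Prod>i<r. D i ^ (e i div n)) * z (\<lambda>i. e i mod n)" for e :: "nat \<Rightarrow> nat"
  \<comment> \<open>From index \<open>r\<close> on, exponents enter \<open>x\<close> only modulo
    \<open>n\<close>, so the corresponding radicals behave as roots of 1.\<close>
  define D' where "D' i = (if i < r then D i else 1)" for i
  have x_cong: "[x e = int n * (\<Prod>i<r. \<kappa> i ^ e i)] (mod int Q)" for e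
  proof -
    have "[x e = (\<Prod>i<r. (\<kappa> i ^ n) ^ (e i div n)) * (int n * (\<Prod>i<r. \<kappa> i ^ (e i mod n)))] (mod int Q)"
      unfolding x_def using n2
      by (intro cong_mult cong_prod cong_pow z) (auto intro: cong_sym \<kappa>)
    also have "(\<Prod>i<r. (\<kappa> i ^ n) ^ (e i div n)) * (int n * (\<Prod>i<r. \<kappa> i ^ (e i mod n))) =
        int n * (\<Prod>i<r. (\<kappa> i ^ n) ^ (e i div n) * \<kappa> i ^ (e i mod n))"
      by (simp add: prod.distrib)
    also have "(\<Prod>i<r. (\<kappa> i ^ n) ^ (e i div n) * \<kappa> i ^ (e i mod n)) = (\<Prod>i<r. \<kappa> i ^ e i)"
      by (simp flip: power_mult power_add)
    finally show ?thesis .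
  qed
  have x_shift: "x (a + f) = (\<Prod>i<r. D i ^ (f i div n)) * x (\<lambda>i. a i + f i mod n)" for a f
  proof -
    have "(a i + f i) div n = f i div n + (a i + f i mod n) div n" for i
      by (metis add.commute add.left_commute div_mult_self4 mod_mult_div_eq n2 not_numeral_le_zero)
    then show ?thesis
      by (simp add: x_def power_add prod.distrib mod_simps)
  qed
  interpret radical_functional "linear_ext x" mono_var D' n
  proof
    fix i g
    have xi: "x ((\<lambda>j. if j = i then n else 0) + f) = D' i * x f" for f
    proof -
      have "(\<Prod>j<r. D j ^ (((if j = i then n else 0) + f j) div n)) =
          (\<Prod>j<r. (if j = i then D' i else 1) * D j ^ (f j div n))"
        using n2 by (intro prod.cong) (auto simp: D'_def)
      also have "\<dots> = D' i * (\<Prod>j<r. D j ^ (f j div n))"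
        by (simp add: prod.distrib prod.delta D'_def)
      moreover have "(\<lambda>j. ((if j = i then n else 0) + f j) mod n) = (\<lambda>j. f j mod n)"
        by auto
      ultimately show ?thesis by (simp add: x_def)
    qed
    show "linear_ext x (mono_var i ^ n * g) = D' i * linear_ext x g"
      by (simp only: mono_var_power linear_ext_single_mult xi) (simp add: linear_ext_def sum_distrib_left mult_ac)
  qed (rule linear_ext_add)
  \<comment> \<open>The largest integer with \<open>B ^ (2 ^ r) \<le> Q\<close>: then
    \<open>(B + 1) ^ (2 ^ r)\<close> exceeds \<open>Q\<close>, as the pigeonhole principle
    requires.\<close>
  define B where "B = nat \<lfloor>real Q powr (1 / 2 ^ r)\<rfloor>"
  have B: "real B \<le> real Q powr (1 / 2 ^ r)" "real Q powr (1 / 2 ^ r) < real (B + 1)"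
    by (simp_all add: B_def) linarith
  have "real Q = (real Q powr (1 / 2 ^ r)) ^ (2 ^ r)"
    using nQ by (simp add: powr_powr flip: powr_realpow)
  also have "\<dots> < real (B + 1) ^ (2 ^ r)"
    using B by (intro power_strict_mono) auto
  finally have "real Q < real ((B + 1) ^ (2 ^ r))"
    by (simp only: of_nat_power)
  then have BQ: "Q < (B + 1) ^ card (Pow {..<r})"
    by (simp only: of_nat_less_iff card_Pow finite_lessThan card_lessThan)
  have Qpos: "Q > 0" using nQ by simp
  obtain c S0 where S0: "S0 \<in> Pow {..<r}" "c S0 \<noteq> 0"
    and cB: "\<And>S. S \<in> Pow {..<r} \<Longrightarrow> \<bar>c S\<bar> \<le> int B"
    and cQ: "[(\<Sum>S\<in>Pow {..<r}. c S * (\<Prod>i\<in>S. \<kappa> i)) = 0] (mod int Q)"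
    by (rule small_linear_relation[OF finite_Pow_iff[THEN iffD2, OF finite_lessThan] BQ Qpos, where \<kappa> = "\<lambda>S. \<Prod>i\<in>S. \<kappa> i"])
      (rule that)
  define ind where "ind S j = (if j \<in> S then 1 else 0 :: nat)" for S and j :: nat
  have prod_ind: "(\<Prod>i<r. \<kappa> i ^ (ind S i + f i)) = (\<Prod>i\<in>S. \<kappa> i) * (\<Prod>i<r. \<kappa> i ^ f i)"
    if "S \<in> Pow {..<r}" for S f
  proof -
    have "(\<Prod>i<r. \<kappa> i ^ ind S i) = (\<Prod>i<r. if i \<in> S then \<kappa> i else 1)"
      by (intro prod.cong) (auto simp: ind_def)
    also have "\<dots> = (\<Prod>i\<in>{..<r} \<inter> S. \<kappa> i)" by (simp add: prod.inter_restrict)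
    also have "{..<r} \<inter> S = S" using that by auto
    finally show ?thesis by (simp add: power_add prod.distrib)
  qed
  \<comment> \<open>For \<open>f i < n\<close> the exponents \<open>ind S i + f i\<close> stay below
    \<open>2 * n\<close>, so each index carries at most once and the factor from the
    \<open>D i\<close> is at most \<open>M ^ r\<close>. The sum is a multiple of \<open>Q\<close> of
    absolute value below \<open>Q\<close>.\<close>
  have rel_reduced: "(\<Sum>S\<in>Pow {..<r}. c S * x (\<lambda>i. ind S i + f i)) = 0" (is "?s = 0")
    if f: "\<And>i. f i < n" for f
  proof (rule ccontr)
    assume nz: "?s \<noteq> 0"
    have "[?s = (\<Sum>S\<in>Pow {..<r}. c S * (int n * ((\<Prod>i\<in>S. \<kappa> i) * (\<Prod>i<r. \<kappa> i ^ f i))))] (mod int Q)"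
    proof (intro cong_sum cong_mult cong_refl)
      fix S assume "S \<in> Pow {..<r}"
      from x_cong[of "\<lambda>i. ind S i + f i", unfolded prod_ind[OF this]]
      show "[x (\<lambda>i. ind S i + f i) = int n * ((\<Prod>i\<in>S. \<kappa> i) * (\<Prod>i<r. \<kappa> i ^ f i))] (mod int Q)" .
    qed
    also have "(\<Sum>S\<in>Pow {..<r}. c S * (int n * ((\<Prod>i\<in>S. \<kappa> i) * (\<Prod>i<r. \<kappa> i ^ f i)))) =
        (\<Sum>S\<in>Pow {..<r}. c S * (\<Prod>i\<in>S. \<kappa> i)) * (int n * (\<Prod>i<r. \<kappa> i ^ f i))"
      by (subst sum_distrib_right) (rule sum.cong, simp_all add: mult_ac)
    also have "[\<dots> = 0 * (int n * (\<Prod>i<r. \<kappa> i ^ f i))] (mod int Q)"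
      by (intro cong_mult cQ cong_refl)
    finally have "int Q dvd ?s" by (simp add: cong_0_iff)
    then have "int Q \<le> \<bar>?s\<bar>" using nz dvd_imp_le_int[of ?s "int Q"] by simp
    then have "real Q \<le> \<bar>real_of_int ?s\<bar>" by linarith
    also have "\<dots> \<le> (\<Sum>S\<in>Pow {..<r}. \<bar>real_of_int (c S * x (\<lambda>i. ind S i + f i))\<bar>)"
      unfolding of_int_sum by (rule sum_abs)
    also have "\<dots> \<le> (\<Sum>S\<in>Pow {..<r}. real Q powr (1 / 2 ^ r) * (M ^ r * Z))"
    proof (rule sum_mono)
      fix S assume S: "S \<in> Pow {..<r}"
      have "\<bar>real_of_int (c S)\<bar> \<le> real B" using cB[OF S] by linarith
      then have 1: "\<bar>real_of_int (c S)\<bar> \<le> real Q powr (1 / 2 ^ r)" using B by linarith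
      have "\<bar>real_of_int (\<Prod>i<r. D i ^ ((ind S i + f i) div n))\<bar> =
          (\<Prod>i<r. \<bar>real_of_int (D i ^ ((ind S i + f i) div n))\<bar>)"
        by (simp add: abs_prod)
      also have "\<dots> \<le> (\<Prod>i<r. M)"
      proof (intro prod_mono conjI)
        fix i assume i: "i \<in> {..<r}"
        have "ind S i + f i < 2 * n" using f[of i] by (simp add: ind_def)
        then have "(ind S i + f i) div n < 2" by (rule less_mult_imp_div_less)
        then have "(ind S i + f i) div n = 0 \<or> (ind S i + f i) div n = 1" by linarith
        then show "\<bar>real_of_int (D i ^ ((ind S i + f i) div n))\<bar> \<le> M"
          using DM[of i] i M by auto
      qed simp
      finally have 2: "\<bar>real_of_int (\<Prod>i<r. D i ^ ((ind S i + f i) div n))\<bar> \<le> M ^ r" by simp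
      have 3: "\<bar>real_of_int (z (\<lambda>i. (ind S i + f i) mod n))\<bar> \<le> Z"
        using n2 by (intro less_imp_le zZ) auto
      have "\<bar>real_of_int (x (\<lambda>i. ind S i + f i))\<bar> \<le> M ^ r * Z"
        unfolding x_def of_int_mult abs_mult using M by (intro mult_mono 2 3) auto
      with 1 show "\<bar>real_of_int (c S * x (\<lambda>i. ind S i + f i))\<bar> \<le> real Q powr (1 / 2 ^ r) * (M ^ r * Z)"
        unfolding of_int_mult abs_mult by (intro mult_mono) auto
    qed
    also have "\<dots> < real Q" using Z by (simp add: card_Pow mult_ac)
    finally show False by simp
  qed
  \<comment> \<open>For a general \<open>f\<close>, the carries already contained in
    \<open>f\<close> form a factor common to all \<open>S\<close>, by
    \<open>x_shift\<close>.\<close>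
  have rel: "(\<Sum>S\<in>Pow {..<r}. c S * x (ind S + f)) = 0" for f
  proof -
    have "(\<Sum>S\<in>Pow {..<r}. c S * x (ind S + f)) =
        (\<Prod>i<r. D i ^ (f i div n)) * (\<Sum>S\<in>Pow {..<r}. c S * x (\<lambda>i. ind S i + f i mod n))"
      unfolding x_shift sum_distrib_left by (simp add: mult_ac)
    also have "\<dots> = 0" using n2 by (subst rel_reduced) auto
    finally show ?thesis .
  qed
  have mono: "of_int (c S) * (\<Prod>i\<in>S. mono_var i) = Poly_Mapping.single (ind S) (c S)" if "S \<in> Pow {..<r}" for S
  proof -
    have "finite S" using that finite_subset by auto
    then show ?thesis
      by (simp add: mono_var_prod ind_def[abs_def] mult_single flip: single_of_int)
  qed
  have "eqv (\<Sum>S\<in>Pow {..<r}. of_int (c S) * (\<Prod>i\<in>S. mono_var i)) 0"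
    unfolding eqv_def
  proof
    fix g :: "(nat \<Rightarrow> nat) \<Rightarrow>\<^sub>0 int"
    have "linear_ext x ((\<Sum>S\<in>Pow {..<r}. of_int (c S) * (\<Prod>i\<in>S. mono_var i)) * g) =
        (\<Sum>S\<in>Pow {..<r}. \<Sum>f\<in>Poly_Mapping.keys g. Poly_Mapping.lookup g f * (c S * x (ind S + f)))"
      unfolding sum_distrib_right linear_ext_sum
      by (intro sum.cong refl) (simp only: mono linear_ext_single_mult)
    also have "\<dots> = (\<Sum>f\<in>Poly_Mapping.keys g. Poly_Mapping.lookup g f * (\<Sum>S\<in>Pow {..<r}. c S * x (ind S + f)))"
      by (subst sum.swap) (simp add: sum_distrib_left)
    also have "\<dots> = linear_ext x (0 * g)" by (simp add: rel linear_ext_def)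
    finally show "linear_ext x ((\<Sum>S\<in>Pow {..<r}. of_int (c S) * (\<Prod>i\<in>S. mono_var i)) * g) =
      linear_ext x (0 * g)" .
  qed
  \<comment> \<open>The functional is not zero: its value at the monomial 1 is congruent to
    \<open>n\<close> modulo \<open>Q\<close>, and \<open>0 < n < Q\<close>.\<close>
  moreover have "linear_ext x (Poly_Mapping.single 0 1) \<noteq> 0"
  proof
    assume "linear_ext x (Poly_Mapping.single 0 1) = 0"
    then have "x 0 = 0" by (simp only: linear_ext_single mult_1)
    then have "[0 = int n] (mod int Q)" using x_cong[of 0] by simp
    then have "Q dvd n" by (metis cong_0_iff cong_sym int_dvd_int_iff)
    then show False using n2 nQ by (auto dest: dvd_imp_le)
  qed
  moreover have "D' i = int (l i) * d i" "D' i = D i" if "i < r" for i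
    using D that by (auto simp: D'_def)
  ultimately have "c S0 = 0"
    using squarefree_monomials_independent[of "Poly_Mapping.single 0 1" r l d c S0] n2 l ln d lD S0(1)
    by auto
  with S0 show False by simp
qed

section \<open>Small primes in a common coset of the power residues\<close>

text \<open>The numbers \<open>1 / (k * (j choose k))\<close> are the entries of Leibniz's harmonic
  triangle. Each entry with \<open>k + 1\<close> is a difference of two entries with
  \<open>k\<close>, so integrality after multiplication by \<open>m\<close> propagates from the
  entries \<open>1 / j\<close>.\<close>

lemma leibniz_triangle_integral:
  fixes m :: nat
  assumes m: "\<And>i. i \<in> {1..N} \<Longrightarrow> i dvd m" and "1 \<le> k" "k \<le> j" "j \<le> N"
  shows "real m / (real k * real (j choose k)) \<in> \<int>"
  using assms(2-)
proof (induction k arbitrary: j rule: nat_induct_at_least)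
  case base
  then have "j dvd m" by (intro m) auto
  then show ?case by (metis Ints_of_nat choose_one mult_1 of_nat_1 real_of_nat_div)
next
  case (Suc k)
  define c where "c = real (j choose k)"
  have c: "c > 0" using Suc by (simp add: c_def)
  have jk: "real j > real k" "real k > 0" using Suc by auto
  have 1: "real (Suc k) * real (j choose Suc k) = (real j - real k) * c"
  proof -
    have "Suc k * (j choose Suc k) = j * (j - 1 choose k)"
      by (rule binomial_absorption)
    also have "\<dots> = (j - k) * (j choose k)"
      using binomial_absorb_comp[of j k] by simp
    finally show ?thesis using Suc.prems unfolding c_def
      by (metis Suc_leD of_nat_diff of_nat_mult)
  qed
  have 2: "real (j - 1 choose k) = c * (real j - real k) / real j"
  proof -
    have "(j - k) * (j choose k) = j * (j - 1 choose k)"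
      using binomial_absorb_comp[of j k] by simp
    then have "(real j - real k) * c = real j * real (j - 1 choose k)"
      using Suc.prems unfolding c_def by (metis Suc_leD of_nat_diff of_nat_mult)
    then show ?thesis using jk by (simp add: field_simps)
  qed
  have "real m / (real (Suc k) * real (j choose Suc k)) =
      real m / (real k * real (j - 1 choose k)) - real m / (real k * real (j choose k))"
    unfolding 1 2 c_def[symmetric] using c jk by (simp add: field_simps)
  moreover have "real m / (real k * real (j - 1 choose k)) \<in> \<int>"
    "real m / (real k * real (j choose k)) \<in> \<int>"
    using Suc.prems by (intro Suc.IH; simp)+
  ultimately show ?case by simp
qed

text \<open>A Chebyshev bound: the least common multiple \<open>m\<close> of
  \<open>1, \<dots>, 2 * k\<close> is a multiple of \<open>k * (2 * k choose k)\<close>, hence at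
  least \<open>4 ^ k / 2\<close>. It is also a product of prime powers, one for each prime up to
  \<open>2 * k\<close> and each at most \<open>2 * k\<close>.\<close>

lemma prime_counting_lower:
  assumes k: "k > 0"
  shows "4 ^ k / 2 \<le> real (2 * k) ^ card {p. prime p \<and> p \<le> 2 * k}"
proof -
  define P where "P = {p. prime p \<and> p \<le> 2 * k}"
  have finP: "finite P" by (rule finite_subset[of _ "{..2 * k}"]) (auto simp: P_def)
  define e where "e p = Max {e. p ^ e \<le> 2 * k}" for p
  have fin: "finite {e. p ^ e \<le> 2 * k}" if "p \<in> P" for p
  proof (rule finite_subset)
    show "{e. p ^ e \<le> 2 * k} \<subseteq> {..2 * k}"
    proof
      fix e assume "e \<in> {e. p ^ e \<le> 2 * k}"
      moreover have "p \<ge> 2" using that by (simp add: P_def prime_ge_2_nat)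
      then have "e < p ^ e" by (simp add: power_gt_expt)
      ultimately show "e \<in> {..2 * k}" by simp
    qed
  qed simp
  define m where "m = (\<Prod>p\<in>P. p ^ e p)"
  have m0: "m > 0" unfolding m_def P_def by (intro prod_pos) (auto simp: prime_gt_0_nat)
  have e_le: "p ^ e p \<le> 2 * k" if "p \<in> P" for p
  proof -
    have "0 \<in> {e. p ^ e \<le> 2 * k}" using k by simp
    then have "e p \<in> {e. p ^ e \<le> 2 * k}"
      unfolding e_def by (intro Max_in fin[OF that]) blast
    then show ?thesis by simp
  qed
  have dvd: "i dvd m" if i: "i \<in> {1..2 * k}" for i
  proof (rule multiplicity_le_imp_dvd)
    fix p :: nat assume p: "prime p"
    show "multiplicity p i \<le> multiplicity p m"
    proof (cases "p \<in> P")
      case True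
      have "p ^ multiplicity p i \<le> i" using i by (intro dvd_imp_le multiplicity_dvd) auto
      then have "multiplicity p i \<le> e p"
        unfolding e_def using i fin[OF True] by (intro Max_ge) auto
      moreover have "p ^ e p dvd m" unfolding m_def using finP True by (rule dvd_prodI)
      then have "e p \<le> multiplicity p m" using m0 p
        by (intro multiplicity_geI) (auto simp: prime_gt_1_nat)
      ultimately show ?thesis by simp
    next
      case False
      then have "p > i" using p i by (auto simp: P_def)
      then have "\<not> p dvd i" using i by (auto dest: dvd_imp_le)
      then show ?thesis by (simp add: not_dvd_imp_multiplicity_0)
    qed
  qed (use i in auto)
  have "real m / (real k * real (2 * k choose k)) \<in> \<int>"
    using k by (intro leibniz_triangle_integral[of "2 * k"] dvd) auto
  then obtain z where z: "real m / (real k * real (2 * k choose k)) = of_int z"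
    by (auto elim: Ints_cases)
  have pos: "real k * real (2 * k choose k) > 0" using k by simp
  have "real m / (real k * real (2 * k choose k)) > 0" using pos m0 by simp
  then have "z \<ge> 1" using z by simp
  then have "real m / (real k * real (2 * k choose k)) \<ge> 1" using z by simp
  then have "real k * real (2 * k choose k) \<le> real m" using pos by (simp add: field_simps)
  moreover have "real k * (4 ^ k / (2 * real k)) \<le> real k * real (2 * k choose k)"
    by (intro mult_left_mono central_binomial_lower_bound k) auto
  ultimately have "4 ^ k / 2 \<le> real m" using k by simp
  also have "m \<le> (\<Prod>p\<in>P. 2 * k)" unfolding m_def by (intro prod_mono) (auto simp: e_le)
  then have "real m \<le> real (2 * k) ^ card P" by (metis of_nat_le_iff of_nat_power prod_constant)
  finally show ?thesis by (simp add: P_def)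
qed

text \<open>With at most \<open>T\<close> primes up to \<open>8 * T^2\<close>, the Chebyshev bound
  would give \<open>4 ^ (4 * T^2) / 2 \<le> (8 * T^2) ^ T \<le> 64 ^ (T^2) = 4 ^ (3 * T^2)\<close>.
  A quadratic bound is enough, since \<open>T\<close> will be a small power of
  \<open>q\<close>.\<close>

lemma many_primes:
  fixes T :: nat
  assumes "T \<ge> 1"
  shows "T < card {p. prime p \<and> p \<le> 8 * T\<^sup>2}"
proof (rule ccontr)
  assume "\<not> ?thesis"
  then have le: "card {p. prime p \<and> p \<le> 2 * (4 * T\<^sup>2)} \<le> T" by simp
  have "T < 2 ^ T" by simp
  then have "T\<^sup>2 \<le> (2 ^ T)\<^sup>2" by (intro power_mono) auto
  then have "8 * T\<^sup>2 \<le> 8 * (2 ^ T)\<^sup>2" by simp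
  also have "(8::nat) * (2 ^ T)\<^sup>2 \<le> 16 ^ T * (2 ^ T)\<^sup>2"
    using power_increasing[of 1 T "16::nat"] assms by (intro mult_right_mono) auto
  also have "\<dots> = 64 ^ T" by (simp flip: power_mult_distrib add: power2_eq_square)
  finally have "8 * T\<^sup>2 \<le> 64 ^ T" .
  then have "real (2 * (4 * T\<^sup>2)) \<le> 64 ^ T"
    by (metis (mono_tags) mult.assoc num_double numeral_times_numeral of_nat_le_iff of_nat_numeral of_nat_power)
  then have 1: "real (2 * (4 * T\<^sup>2)) ^ T \<le> (64 ^ T) ^ T" by (intro power_mono) auto
  have "(4::real) ^ (4 * T\<^sup>2) / 2 \<le> real (2 * (4 * T\<^sup>2)) ^ card {p. prime p \<and> p \<le> 2 * (4 * T\<^sup>2)}"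
    using assms by (intro prime_counting_lower) auto
  also have "\<dots> \<le> real (2 * (4 * T\<^sup>2)) ^ T"
  proof (intro power_increasing le)
    have "T\<^sup>2 \<ge> 1" using assms by (simp add: Suc_le_eq)
    then have "1 \<le> 2 * (4 * T\<^sup>2)" by linarith
    then show "1 \<le> real (2 * (4 * T\<^sup>2))" by (metis of_nat_1 of_nat_mono)
  qed
  also note 1
  also have "((64::real) ^ T) ^ T = 4 ^ (3 * T\<^sup>2)"
    by (simp add: power2_eq_square power_mult)
  finally have "(4::real) ^ (T\<^sup>2) * 4 ^ (3 * T\<^sup>2) \<le> 2 * 4 ^ (3 * T\<^sup>2)"
    by (simp flip: power_add)
  then have "(4::real) ^ (T\<^sup>2) \<le> 2" by simp
  moreover have "(4::real) ^ 1 \<le> 4 ^ (T\<^sup>2)"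
    using assms by (intro power_increasing) auto
  ultimately show False by simp
qed

text \<open>As in the divisor bound, a prime \<open>p > K powr (1 / \<delta>)\<close> pays for its
  factor \<open>K\<close> by \<open>p powr \<delta>\<close>. The finitely many smaller primes, the
  set \<open>B\<close>, cost at most the constant \<open>K ^ card B\<close>.\<close>

lemma power_omega_bound:
  fixes K \<delta> :: real
  assumes K: "K \<ge> 1" and \<delta>: "\<delta> > 0"
  obtains C where "C \<ge> 1" "\<And>q::nat. q > 0 \<Longrightarrow> K ^ card (prime_factors q) \<le> C * real q powr \<delta>"
proof -
  define B where "B = {p. real p \<le> K powr (1 / \<delta>)}"
  have "B \<subseteq> {..nat \<lfloor>K powr (1 / \<delta>)\<rfloor>}" by (auto simp: B_def le_nat_floor)
  then have finB: "finite B" by (rule finite_subset) simp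
  have "K ^ card (prime_factors q) \<le> K ^ card B * real q powr \<delta>" if q: "q > 0" for q :: nat
  proof -
    have "K ^ card (prime_factors q) = (\<Prod>p\<in>prime_factors q. K)" by simp
    also have "\<dots> \<le> (\<Prod>p\<in>prime_factors q. (if p \<in> B then K else 1) * real p powr \<delta>)"
    proof (intro prod_mono conjI)
      fix p assume "p \<in> prime_factors q"
      then have p: "p \<ge> 2" by (simp add: in_prime_factors_iff prime_ge_2_nat)
      show "K \<le> (if p \<in> B then K else 1) * real p powr \<delta>"
      proof (cases "p \<in> B")
        case True
        have "1 \<le> real p powr \<delta>" using p \<delta> by (intro ge_one_powr_ge_zero) auto
        then show ?thesis using True K by simp
      next
        case False
        have "K = (K powr (1 / \<delta>)) powr \<delta>" using K \<delta> by (simp add: powr_powr)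
        also have "\<dots> \<le> real p powr \<delta>" using False \<delta> by (intro powr_mono2) (auto simp: B_def)
        finally show ?thesis using False by simp
      qed
    qed (use K in auto)
    also have "\<dots> = (\<Prod>p\<in>prime_factors q. if p \<in> B then K else 1) * (\<Prod>p\<in>prime_factors q. real p powr \<delta>)"
      by (rule prod.distrib)
    also have "\<dots> \<le> K ^ card B * real q powr \<delta>"
    proof (rule mult_mono)
      have "(\<Prod>p\<in>prime_factors q. if p \<in> B then K else 1) = K ^ card (prime_factors q \<inter> B)"
        by (simp add: prod.inter_restrict[symmetric])
      also have "\<dots> \<le> K ^ card B" using K finB by (intro power_increasing card_mono) auto
      finally show "(\<Prod>p\<in>prime_factors q. if p \<in> B then K else 1) \<le> K ^ card B" .
      have "(\<Prod>p\<in>prime_factors q. p) dvd (\<Prod>p\<in>prime_factors q. p ^ multiplicity p q)"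
        by (intro prod_dvd_prod) (auto simp: in_prime_factors_iff prime_multiplicity_gt_zero_iff prime_elem_multiplicity_eq_zero_iff intro!: dvd_power)
      then have "(\<Prod>p\<in>prime_factors q. p) dvd q"
        using prime_factorization_nat[OF q] by simp
      then have "(\<Prod>p\<in>prime_factors q. p) \<le> q" using q by (rule dvd_imp_le)
      then have "(\<Prod>p\<in>prime_factors q. real p) powr \<delta> \<le> real q powr \<delta>"
        using \<delta> by (intro powr_mono2) (auto simp flip: of_nat_prod intro: prod_nonneg)
      then show "(\<Prod>p\<in>prime_factors q. real p powr \<delta>) \<le> real q powr \<delta>"
        by (simp add: prod_powr_distrib)
    qed (use K in \<open>auto intro: prod_nonneg\<close>)
    finally show ?thesis .
  qed
  moreover have "K ^ card B \<ge> 1" using K by simp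
  ultimately show ?thesis using that by blast
qed

section \<open>Counting roots of unity modulo \<open>Q\<close>\<close>

definition torsion :: "nat \<Rightarrow> nat \<Rightarrow> nat set" where
  "torsion n Q = {u\<in>{..<Q}. [u ^ n = 1] (mod Q)}"

lemma finite_torsion [simp]: "finite (torsion n Q)"
  by (simp add: torsion_def)

text \<open>Write \<open>u ^ n - v ^ n = (u - v) * S\<close>. If \<open>u\<close> and
  \<open>v\<close> agree modulo \<open>p ^ (b + 1)\<close> with \<open>b = multiplicity p n\<close>,
  then \<open>S\<close> is congruent to \<open>n * u ^ (n - 1)\<close>, so
  \<open>p ^ (b + 1)\<close> does not divide \<open>S\<close>. At least \<open>a - b\<close> factors
  \<open>p\<close> are therefore left for \<open>u - v\<close>. The argument is uniform in
  \<open>p\<close>, including \<open>p = 2\<close>.\<close>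

lemma torsion_prime_power_cong:
  fixes p a n :: nat and u v :: int
  assumes p: "prime p" and n: "n > 0" and a: "a > 0"
    and u: "[u ^ n = 1] (mod int (p ^ a))" and v: "[v ^ n = 1] (mod int (p ^ a))"
    and uv: "[u = v] (mod int (p ^ Suc (multiplicity p n)))"
  shows "[u = v] (mod int (p ^ (a - multiplicity p n)))"
proof (cases "u = v")
  case False
  define b where "b = multiplicity p n"
  define S where "S = (\<Sum>i<n. v ^ (n - Suc i) * u ^ i)"
  have pe: "prime (int p)" using p by simp
  have "[u ^ n = v ^ n] (mod int (p ^ a))" using u v cong_sym cong_trans by blast
  then have "int p ^ a dvd u ^ n - v ^ n" by (simp add: cong_iff_dvd_diff)
  also have "u ^ n - v ^ n = (u - v) * S"
    unfolding S_def by (rule power_diff_sumr2)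
  finally have dvd: "int p ^ a dvd (u - v) * S" .
  have up: "\<not> int p dvd u"
  proof
    assume "int p dvd u"
    then have "int p dvd u ^ n" using n by (simp add: dvd_power_iff_le dvd_trans[OF _ dvd_power])
    moreover have "int p dvd int (p ^ a)" using a by simp
    then have "[u ^ n = 1] (mod int p)" using u cong_dvd_modulus by blast
    ultimately have "int p dvd 1" by (metis cong_dvd_iff)
    then show False using pe not_prime_unit by blast
  qed
  have "[S = (\<Sum>i<n. u ^ (n - Suc i) * u ^ i)] (mod int (p ^ Suc b))"
    unfolding S_def b_def by (intro cong_sum cong_mult cong_pow cong_refl cong_sym[OF uv])
  also have "(\<Sum>i<n. u ^ (n - Suc i) * u ^ i) = int n * u ^ (n - 1)"
    by (simp flip: power_add)
  finally have S: "[S = int n * u ^ (n - 1)] (mod int p ^ Suc b)" by simp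
  have nS: "\<not> int p ^ Suc b dvd S"
  proof
    assume "int p ^ Suc b dvd S"
    then have "int p ^ Suc b dvd u ^ (n - 1) * int n"
      using cong_dvd_iff[OF S] by (simp add: mult.commute)
    moreover have "\<not> int p dvd u ^ (n - 1)" using up pe prime_dvd_power by blast
    ultimately have "int p ^ Suc b dvd int n"
      by (rule prime_power_dvd_multD[OF prime_imp_prime_elem[OF pe] _ zero_less_Suc])
    then have "int (p ^ Suc b) dvd int n" by simp
    then have "p ^ Suc b dvd n" by (simp only: int_dvd_int_iff)
    then have "Suc b \<le> multiplicity p n"
      using n p by (intro multiplicity_geI) (auto simp: prime_gt_1_nat)
    then show False by (simp add: b_def)
  qed
  then have S0: "S \<noteq> 0" by auto
  have pu: "\<not> is_unit (int p)" using pe not_prime_unit by blast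
  have "a \<le> multiplicity (int p) ((u - v) * S)"
    using dvd False S0 pu by (intro multiplicity_geI) auto
  also have "\<dots> = multiplicity (int p) (u - v) + multiplicity (int p) S"
    using pe False S0 by (intro prime_elem_multiplicity_mult_distrib) auto
  also have "multiplicity (int p) S < Suc b"
    using nS S0 pu by (metis not_le_imp_less power_dvd_iff_le_multiplicity)
  finally have "a - b \<le> multiplicity (int p) (u - v)" by linarith
  then have "int p ^ (a - b) dvd u - v" by (rule multiplicity_dvd')
  then show ?thesis by (simp add: cong_iff_dvd_diff b_def)
qed simp

text \<open>For \<open>p\<close> not dividing \<open>n\<close>, a root of unity is determined modulo
  \<open>p\<close>, where there are at most \<open>n\<close>. Otherwise it is determined by its
  residue modulo \<open>p ^ (b + 1)\<close> and its quotient by \<open>p ^ (a - b)\<close>. That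
  leaves at most \<open>p * p ^ b * p ^ b\<close> choices, and both \<open>p\<close> and
  \<open>p ^ b\<close> divide \<open>n\<close>.\<close>

lemma card_torsion_prime_power:
  assumes p: "prime p" and n: "n > 0" and a: "a > 0"
  shows "card (torsion n (p ^ a)) \<le> n ^ 3"
proof -
  define b where "b = multiplicity p n"
  have p0: "p > 0" using p prime_gt_0_nat by blast
  have key: "[u = v] (mod p ^ (a - b))"
    if "u \<in> torsion n (p ^ a)" "v \<in> torsion n (p ^ a)" "[u = v] (mod p ^ Suc b)" for u v
  proof -
    have "[int x ^ n = 1] (mod int (p ^ a))" if "x \<in> torsion n (p ^ a)" for x
      using that cong_int_iff[of "x ^ n" 1 "p ^ a"] by (simp add: torsion_def)
    moreover have "[int u = int v] (mod int (p ^ Suc (multiplicity p n)))"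
      using that(3) by (simp only: cong_int_iff b_def)
    ultimately have "[int u = int v] (mod int (p ^ (a - multiplicity p n)))"
      using that(1,2) by (intro torsion_prime_power_cong[OF p n a])
    then show ?thesis by (simp only: cong_int_iff b_def)
  qed
  show ?thesis
  proof (cases "p dvd n")
    case False
    then have b0: "b = 0" by (simp add: b_def not_dvd_imp_multiplicity_0)
    have "inj_on (\<lambda>u. u mod p) (torsion n (p ^ a))"
    proof (rule inj_onI)
      fix u v assume uv: "u \<in> torsion n (p ^ a)" "v \<in> torsion n (p ^ a)" "u mod p = v mod p"
      then have "[u = v] (mod p ^ a)" using key[of u v] by (simp add: b0 cong_def)
      then show "u = v" using uv by (simp add: torsion_def cong_less_modulus_unique_nat)
    qed
    moreover have "(\<lambda>u. u mod p) ` torsion n (p ^ a) \<subseteq> {x\<in>{..<p}. [x ^ n = 1] (mod p)}"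
    proof safe
      fix u assume "u \<in> torsion n (p ^ a)"
      then have "[u ^ n = 1] (mod p)"
        using a by (auto simp: torsion_def elim: cong_dvd_modulus_nat)
      then show "[(u mod p) ^ n = 1] (mod p)" by (simp add: cong_def power_mod)
    qed (use p0 in auto)
    ultimately have "card (torsion n (p ^ a)) \<le> card {x\<in>{..<p}. [x ^ n = 1] (mod p)}"
      by (intro card_inj_on_le) auto
    also have "\<dots> \<le> n" using p n by (rule roots_mod_prime_bound)
    also have "n \<le> n ^ 3" using n by (simp add: self_le_power)
    finally show ?thesis .
  next
    case True
    define f where "f u = (u mod p ^ Suc b, u div p ^ (a - b))" for u
    have "inj_on f (torsion n (p ^ a))"
    proof (rule inj_onI)
      fix u v assume uv: "u \<in> torsion n (p ^ a)" "v \<in> torsion n (p ^ a)" "f u = f v"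
      then have "[u = v] (mod p ^ (a - b))" by (intro key) (auto simp: f_def cong_def)
      then show "u = v" using uv(3) by (simp add: f_def cong_def) (metis div_mult_mod_eq)
    qed
    moreover have "f ` torsion n (p ^ a) \<subseteq> {..<p ^ Suc b} \<times> {..<p ^ b}"
    proof
      fix y assume "y \<in> f ` torsion n (p ^ a)"
      then obtain u where u: "u < p ^ a" "y = f u" by (auto simp: torsion_def)
      have "p ^ a \<le> p ^ b * p ^ (a - b)"
        unfolding power_add[symmetric] using p0 by (intro power_increasing) auto
      then have "u < p ^ b * p ^ (a - b)" using u by simp
      then have "u div p ^ (a - b) < p ^ b" by (rule less_mult_imp_div_less)
      then show "y \<in> {..<p ^ Suc b} \<times> {..<p ^ b}" using u p0 by (simp add: f_def)
    qed
    ultimately have "card (torsion n (p ^ a)) \<le> card ({..<p ^ Suc b} \<times> {..<p ^ b})"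
      by (intro card_inj_on_le) auto
    also have "\<dots> = p * p ^ b * p ^ b" by (simp add: card_cartesian_product)
    also have "\<dots> \<le> n * n * n"
    proof (intro mult_mono)
      show "p \<le> n" using True n by (rule dvd_imp_le)
      show "p ^ b \<le> n" unfolding b_def using n by (intro dvd_imp_le multiplicity_dvd) auto
      then show "p ^ b \<le> n" .
    qed auto
    finally show ?thesis by (simp add: power3_eq_cube)
  qed
qed

lemma card_torsion:
  assumes n: "n > 0" and Q: "Q > 0"
  shows "card (torsion n Q) \<le> (n ^ 3) ^ card (prime_factors Q)"
proof -
  define f where "f u = (\<lambda>p\<in>prime_factors Q. u mod p ^ multiplicity p Q)" for u
  have mult_pos: "multiplicity p Q > 0" if "p \<in> prime_factors Q" for p
    using that by (simp add: prime_factors_multiplicity)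
  have "inj_on f (torsion n Q)"
  proof (rule inj_onI)
    fix u v assume uv: "u \<in> torsion n Q" "v \<in> torsion n Q" "f u = f v"
    have "[u = v] (mod (\<Prod>p\<in>prime_factors Q. p ^ multiplicity p Q))"
    proof (rule coprime_cong_prod_nat)
      fix p assume "p \<in> prime_factors Q"
      then show "[u = v] (mod p ^ multiplicity p Q)"
        using fun_cong[OF uv(3), of p] by (simp add: f_def cong_def)
    next
      fix p p' assume "p \<in> prime_factors Q" "p' \<in> prime_factors Q" "p \<noteq> p'"
      then have "coprime p p'" by (intro primes_coprime) auto
      then show "coprime (p ^ multiplicity p Q) (p' ^ multiplicity p' Q)" by simp
    qed
    then have "[u = v] (mod Q)" using prime_factorization_nat[OF Q] by simp
    then show "u = v" using uv by (simp add: torsion_def cong_less_modulus_unique_nat)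
  qed
  moreover have "f ` torsion n Q \<subseteq> (\<Pi>\<^sub>E p\<in>prime_factors Q. torsion n (p ^ multiplicity p Q))"
  proof
    fix y assume "y \<in> f ` torsion n Q"
    then obtain u where u: "u \<in> torsion n Q" "y = f u" by auto
    have "u mod p ^ multiplicity p Q \<in> torsion n (p ^ multiplicity p Q)" if "p \<in> prime_factors Q" for p
    proof -
      have "p ^ multiplicity p Q dvd Q" by (rule multiplicity_dvd)
      then have "[u ^ n = 1] (mod p ^ multiplicity p Q)"
        using u by (auto simp: torsion_def elim: cong_dvd_modulus_nat)
      moreover have "p > 0" using that by (auto simp: in_prime_factors_iff prime_gt_0_nat)
      ultimately show ?thesis by (simp add: torsion_def cong_def power_mod)
    qed
    then show "y \<in> (\<Pi>\<^sub>E p\<in>prime_factors Q. torsion n (p ^ multiplicity p Q))"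
      using u by (auto simp: f_def)
  qed
  ultimately have "card (torsion n Q) \<le> card (\<Pi>\<^sub>E p\<in>prime_factors Q. torsion n (p ^ multiplicity p Q))"
    by (intro card_inj_on_le finite_PiE) auto
  also have "\<dots> = (\<Prod>p\<in>prime_factors Q. card (torsion n (p ^ multiplicity p Q)))"
    by (simp add: card_PiE)
  also have "\<dots> \<le> (\<Prod>p\<in>prime_factors Q. n ^ 3)"
    by (intro prod_mono conjI card_torsion_prime_power) (auto simp: n mult_pos)
  finally show ?thesis by simp
qed

text \<open>Multiplication by the inverse of one fixed solution carries all solutions injectively to
  roots of unity.\<close>

lemma power_fiber_le_torsion:
  fixes Q n l w :: nat
  assumes Q: "Q > 0" and l: "coprime l Q"
  shows "card {u\<in>{..<Q}. coprime u Q \<and> [l * u ^ n = w] (mod Q)} \<le> card (torsion n Q)" (is "card ?F \<le> _")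
proof (cases "?F = {}")
  case False
  then obtain u0 where u0: "coprime u0 Q" "[l * u0 ^ n = w] (mod Q)" by auto
  then obtain v where v: "[u0 * v = 1] (mod Q)"
    using cong_solve_coprime_nat by auto
  then have cv: "coprime v Q"
    by (metis cong_imp_coprime cong_sym coprime_1_left coprime_mult_left_iff)
  have "inj_on (\<lambda>u. u * v mod Q) ?F"
  proof (rule inj_onI)
    fix x y assume xy: "x \<in> ?F" "y \<in> ?F" "x * v mod Q = y * v mod Q"
    then have "[x * v = y * v] (mod Q)" by (simp add: cong_def)
    then have "[x = y] (mod Q)" by (simp add: cong_mult_rcancel_nat cv)
    then show "x = y" using xy by (simp add: cong_less_modulus_unique_nat)
  qed
  moreover have "(\<lambda>u. u * v mod Q) ` ?F \<subseteq> torsion n Q"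
  proof safe
    fix u assume u: "u < Q" "coprime u Q" "[l * u ^ n = w] (mod Q)"
    then have "[l * u ^ n = l * u0 ^ n] (mod Q)" using u0 cong_sym cong_trans by blast
    then have "[u ^ n = u0 ^ n] (mod Q)" using l by (simp add: cong_mult_lcancel_nat coprime_commute)
    then have "[u ^ n * v ^ n = u0 ^ n * v ^ n] (mod Q)" by (rule cong_scalar_right)
    also have "[u0 ^ n * v ^ n = 1] (mod Q)"
      using cong_pow[OF v, of n] by (simp add: power_mult_distrib)
    finally have "[(u * v) ^ n = 1] (mod Q)" by (simp add: power_mult_distrib)
    then show "u * v mod Q \<in> torsion n Q" using Q by (simp add: torsion_def cong_def power_mod)
  qed
  ultimately show ?thesis by (intro card_inj_on_le) auto
next
  case True
  then show ?thesis by (metis card.empty le0)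
qed

text \<open>
  Some residue \<open>w\<close> is of the form \<open>l * u ^ n\<close> for at least \<open>card P\<close> pairs \<open>(l, u)\<close>, and each
  \<open>l\<close> occurs in at most \<open>card (torsion n Q)\<close> of them.
\<close>
lemma common_power_coset:
  fixes Q n r :: nat and P :: "nat set"
  assumes Q: "Q > 0" and finP: "finite P" and cop: "\<And>l. l \<in> P \<Longrightarrow> coprime l Q"
    and card: "card P > r * card (torsion n Q)"
  obtains w L where "L \<subseteq> P" "card L > r"
    "\<And>l. l \<in> L \<Longrightarrow> \<exists>u. coprime u Q \<and> [l * u ^ n = w] (mod Q)"
proof -
  define U where "U = {u\<in>{..<Q}. coprime u Q}"
  have finU: "finite U" by (simp add: U_def)
  \<comment> \<open>For \<open>Q = 1\<close> the only unit residue is 0, hence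
    \<open>1 mod Q\<close>.\<close>
  have "1 mod Q \<in> U" using Q by (cases "Q = 1") (auto simp: U_def)
  then have U0: "card U > 0" using finU card_gt_0_iff by blast
  define F where "F w = {(l, u). l \<in> P \<and> u \<in> U \<and> [l * u ^ n = w] (mod Q)}" for w
  have F: "F w = (SIGMA l:P. {u\<in>{..<Q}. coprime u Q \<and> [l * u ^ n = w] (mod Q)})" for w
    by (auto simp: F_def U_def)
  have "P \<times> U \<subseteq> (\<Union>w\<in>U. F w)"
  proof
    fix y assume "y \<in> P \<times> U"
    then obtain l u where y: "y = (l, u)" "l \<in> P" "u \<in> U" by auto
    have "coprime (l * u ^ n) Q" using cop[OF y(2)] y(3) by (simp add: U_def)
    then have "(l * u ^ n) mod Q \<in> U" using Q by (simp add: U_def)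
    moreover have "y \<in> F ((l * u ^ n) mod Q)" using y by (simp add: F_def cong_def)
    ultimately show "y \<in> (\<Union>w\<in>U. F w)" by blast
  qed
  then have "card (P \<times> U) \<le> card (\<Union>w\<in>U. F w)"
    using finP finU by (intro card_mono) (auto simp: F)
  also have "\<dots> \<le> (\<Sum>w\<in>U. card (F w))" by (rule card_UN_le[OF finU])
  finally have le: "card P * card U \<le> (\<Sum>w\<in>U. card (F w))" by (simp add: card_cartesian_product)
  obtain w where w: "w \<in> U" "card P \<le> card (F w)"
  proof (rule ccontr)
    assume "\<not> thesis"
    then have "card (F w) < card P" if "w \<in> U" for w using that \<open>\<And>w. _ \<Longrightarrow> _ \<Longrightarrow> thesis\<close> by (meson not_le)
    then have "(\<Sum>w\<in>U. card (F w)) < (\<Sum>w\<in>U. card P)"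
      using finU U0 by (intro sum_strict_mono) auto
    then show False using le by (simp add: mult.commute)
  qed
  define L where "L = {l\<in>P. \<exists>u. coprime u Q \<and> [l * u ^ n = w] (mod Q)}"
  have finL: "finite L" using finP by (simp add: L_def)
  have "F w \<subseteq> (SIGMA l:L. {u\<in>{..<Q}. coprime u Q \<and> [l * u ^ n = w] (mod Q)})"
    by (auto simp: F L_def)
  then have "card (F w) \<le> card (SIGMA l:L. {u\<in>{..<Q}. coprime u Q \<and> [l * u ^ n = w] (mod Q)})"
    using finL by (intro card_mono) auto
  also have "\<dots> = (\<Sum>l\<in>L. card {u\<in>{..<Q}. coprime u Q \<and> [l * u ^ n = w] (mod Q)})"
    using finL by (intro card_SigmaI) auto
  also have "\<dots> \<le> (\<Sum>l\<in>L. card (torsion n Q))"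
    by (intro sum_mono power_fiber_le_torsion Q cop) (auto simp: L_def)
  finally have "card (F w) \<le> card L * card (torsion n Q)" by simp
  then have "r * card (torsion n Q) < card L * card (torsion n Q)"
    using w(2) card by linarith
  then have "card L > r" by simp
  then show ?thesis by (intro that[of L w]) (auto simp: L_def)
qed

text \<open>The last prime \<open>l r\<close> is the reference for the coset: if
  \<open>l i * u ^ n\<close> and \<open>l r * v ^ n\<close> agree, then
  \<open>l i * l r ^ (n - 1)\<close> is the \<open>n\<close>-th power of \<open>l r * v / u\<close>.
  The primes stay small because the number of roots of unity and the number of primes dividing
  \<open>q * n\<close> are both bounded by a constant times
  \<open>q powr (\<delta> / 2)\<close>.\<close>

lemma radical_primes:
  fixes n r :: nat and \<delta> :: real
  assumes n: "n > 0" and \<delta>: "\<delta> > 0"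
  obtains C where "C \<ge> 1"
    "\<And>q::nat. q > 0 \<Longrightarrow> \<exists>(l :: nat \<Rightarrow> nat) (\<kappa> :: nat \<Rightarrow> nat).
      inj_on l {..r} \<and>
      (\<forall>i\<le>r. prime (l i) \<and> \<not> l i dvd n \<and> coprime (l i) (q\<^sup>2) \<and> real (l i) \<le> C * real q powr \<delta>
         \<and> [\<kappa> i ^ n = l i * l r ^ (n - 1)] (mod q\<^sup>2))"
proof -
  obtain C1 where C1: "C1 \<ge> 1"
    "\<And>q::nat. q > 0 \<Longrightarrow> real (n ^ 3) ^ card (prime_factors q) \<le> C1 * real q powr (\<delta> / 2)"
    using power_omega_bound[of "real (n ^ 3)" "\<delta> / 2"] n \<delta> by (auto simp: Suc_le_eq)
  obtain C2 where C2: "C2 \<ge> 1"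
    "\<And>q::nat. q > 0 \<Longrightarrow> 2 ^ card (prime_factors q) \<le> C2 * real q powr (\<delta> / 2)"
    using power_omega_bound[of 2 "\<delta> / 2"] \<delta> by auto
  define C0 where "C0 = real r * C1 + C2 * real n powr (\<delta> / 2) + 1"
  have C0: "C0 \<ge> 1" using C1 C2 by (simp add: C0_def)
  define C where "C = 8 * C0\<^sup>2"
  have "C0\<^sup>2 \<ge> 1" using C0 by simp
  then have "C \<ge> 1" unfolding C_def by linarith
  moreover have "\<exists>(l :: nat \<Rightarrow> nat) (\<kappa> :: nat \<Rightarrow> nat). inj_on l {..r} \<and>
      (\<forall>i\<le>r. prime (l i) \<and> \<not> l i dvd n \<and> coprime (l i) (q\<^sup>2) \<and> real (l i) \<le> C * real q powr \<delta>
         \<and> [\<kappa> i ^ n = l i * l r ^ (n - 1)] (mod q\<^sup>2))" if q: "q > 0" for q :: nat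
  proof -
    define Q where "Q = q\<^sup>2"
    have Q: "Q > 0" using q by (simp add: Q_def)
    define \<tau> where "\<tau> = card (torsion n Q)"
    \<comment> \<open>Large enough that, after the primes dividing \<open>q * n\<close> are removed,
      more than \<open>r * \<tau>\<close> primes up to \<open>8 * T^2\<close> remain. The final 1
      ensures \<open>T \<ge> 1\<close>.\<close>
    define T where "T = r * \<tau> + card (prime_factors (q * n)) + 1"
    define P where "P = {p. prime p \<and> p \<le> 8 * T\<^sup>2} - prime_factors (q * n)"
    have fin: "finite {p. prime p \<and> p \<le> 8 * T\<^sup>2}"
      by (rule finite_subset[of _ "{..8 * T\<^sup>2}"]) auto
    have "T < card {p. prime p \<and> p \<le> 8 * T\<^sup>2}" by (rule many_primes) (simp add: T_def)
    also have "\<dots> \<le> card P + card (prime_factors (q * n))"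
      using diff_card_le_card_Diff[of "prime_factors (q * n)" "{p. prime p \<and> p \<le> 8 * T\<^sup>2}"]
      unfolding P_def by simp
    finally have cardP: "card P > r * \<tau>" by (simp add: T_def)
    have P: "prime l" "\<not> l dvd n" "coprime l Q" "l \<le> 8 * T\<^sup>2" if "l \<in> P" for l
    proof -
      show l: "prime l" "l \<le> 8 * T\<^sup>2" using that by (auto simp: P_def)
      have "\<not> l dvd q * n" using that l q n by (auto simp: P_def in_prime_factors_iff)
      then have "\<not> l dvd q" "\<not> l dvd n" by auto
      then show "\<not> l dvd n" "coprime l Q" using l by (auto simp: Q_def prime_imp_coprime)
    qed
    obtain w L where L: "L \<subseteq> P" "card L > r"
      "\<And>l. l \<in> L \<Longrightarrow> \<exists>u. coprime u Q \<and> [l * u ^ n = w] (mod Q)"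
      using common_power_coset[of Q P r n] Q fin P(3) cardP unfolding \<tau>_def
      by (metis P_def finite_Diff)
    have "finite L" using L(1) fin P_def finite_subset by blast
    then obtain l where l: "bij_betw l {..<card L} L"
      using ex_bij_betw_nat_finite atLeast0LessThan by metis
    have lL: "l i \<in> L" if "i \<le> r" for i
      using l L(2) that by (auto simp: bij_betw_def)
    have inj: "inj_on l {..r}"
      using l L(2) by (auto simp: bij_betw_def intro: inj_on_subset)
    have "\<exists>k. [k ^ n = l i * l r ^ (n - 1)] (mod Q)" if i: "i \<le> r" for i
    proof -
      obtain u where u: "coprime u Q" "[l i * u ^ n = w] (mod Q)" using L(3) lL i by blast
      obtain v where v: "[l r * v ^ n = w] (mod Q)" using L(3) lL by blast
      obtain u' where u': "[u * u' = 1] (mod Q)"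
        using u(1) cong_solve_coprime_nat by auto
      have "(l r * v * u') ^ n = l r ^ (n - 1) * (l r * v ^ n * u' ^ n)"
        using n by (cases n) (simp_all add: power_mult_distrib mult_ac)
      also have "[\<dots> = l r ^ (n - 1) * (l i * u ^ n * u' ^ n)] (mod Q)"
        by (rule cong_scalar_left[OF cong_scalar_right[OF cong_trans[OF v cong_sym[OF u(2)]]]])
      also have "l r ^ (n - 1) * (l i * u ^ n * u' ^ n) = l i * l r ^ (n - 1) * (u * u') ^ n"
        by (simp add: power_mult_distrib mult_ac)
      also have "[\<dots> = l i * l r ^ (n - 1) * 1 ^ n] (mod Q)"
        by (rule cong_scalar_left[OF cong_pow[OF u']])
      finally show ?thesis by auto
    qed
    then obtain \<kappa> where \<kappa>: "\<And>i. i \<le> r \<Longrightarrow> [\<kappa> i ^ n = l i * l r ^ (n - 1)] (mod Q)" by metis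
    have "real \<tau> \<le> real ((n ^ 3) ^ card (prime_factors Q))"
      unfolding \<tau>_def of_nat_le_iff using n Q by (rule card_torsion)
    also have "prime_factors Q = prime_factors q"
      using q by (simp add: Q_def prime_factors_power)
    also have "real ((n ^ 3) ^ card (prime_factors q)) \<le> C1 * real q powr (\<delta> / 2)"
      using C1(2)[OF q] by simp
    finally have \<tau>: "real \<tau> \<le> C1 * real q powr (\<delta> / 2)" .
    \<comment> \<open>The crude bound by a power of 2 brings the count of prime factors under
      \<open>power_omega_bound\<close>.\<close>
    have "real (card (prime_factors (q * n))) < 2 ^ card (prime_factors (q * n))"
      by (rule of_nat_less_two_power)
    also have "\<dots> \<le> C2 * real (q * n) powr (\<delta> / 2)" using q n by (intro C2) auto
    finally have \<omega>: "real (card (prime_factors (q * n))) \<le> C2 * real n powr (\<delta> / 2) * real q powr (\<delta> / 2)"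
      by (simp add: powr_mult mult_ac)
    have q1: "1 \<le> real q powr (\<delta> / 2)" using q \<delta> by (intro ge_one_powr_ge_zero) auto
    have "real T = real r * real \<tau> + real (card (prime_factors (q * n))) + 1"
      by (simp add: T_def)
    also have "\<dots> \<le> real r * (C1 * real q powr (\<delta> / 2)) +
        C2 * real n powr (\<delta> / 2) * real q powr (\<delta> / 2) + real q powr (\<delta> / 2)"
      by (intro add_mono mult_left_mono \<tau> \<omega> q1) auto
    also have "\<dots> = C0 * real q powr (\<delta> / 2)" by (simp add: C0_def algebra_simps)
    finally have "(real T)\<^sup>2 \<le> (C0 * real q powr (\<delta> / 2))\<^sup>2" by (intro power_mono) auto
    also have "\<dots> = C0\<^sup>2 * real q powr \<delta>"
      by (simp add: power_mult_distrib power2_eq_square flip: powr_add)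
    finally have T: "real (8 * T\<^sup>2) \<le> C * real q powr \<delta>" by (simp add: C_def)
    have "real (l i) \<le> C * real q powr \<delta>" if "i \<le> r" for i
    proof -
      have "l i \<le> 8 * T\<^sup>2" using P(4) lL[OF that] L(1) by blast
      then have "real (l i) \<le> real (8 * T\<^sup>2)" by (rule of_nat_mono)
      with T show ?thesis by linarith
    qed
    moreover have "prime (l i)" "\<not> l i dvd n" "coprime (l i) Q" if "i \<le> r" for i
      using P lL[OF that] L(1) by blast+
    ultimately show ?thesis using inj \<kappa> unfolding Q_def by blast
  qed
  ultimately show ?thesis using that by blast
qed

section \<open>Diagonal residues and their lifts\<close>

definition block_matrix :: "'n::finite \<Rightarrow> 'n \<Rightarrow> int \<Rightarrow> int \<Rightarrow> int \<Rightarrow> int \<Rightarrow> int ^ 'n ^ 'n" where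
  "block_matrix i j a b c d = (\<chi> s t.
     if s = i then (if t = i then a else if t = j then b else 0)
     else if s = j then (if t = i then c else if t = j then d else 0)
     else if s = t then 1 else 0)"

lemma det_block_matrix_row1:
  assumes "i \<noteq> j"
  shows "det (block_matrix i j (a + k * c) (b + k * d) c d) = det (block_matrix i j a b c d)"
proof -
  have "(\<chi> s. if s = i then row i (block_matrix i j a b c d) + k *s row j (block_matrix i j a b c d)
      else row s (block_matrix i j a b c d)) = block_matrix i j (a + k * c) (b + k * d) c d"
    using assms by (auto simp: vec_eq_iff row_def block_matrix_def)
  then show ?thesis using det_row_operation[OF assms, of "block_matrix i j a b c d" k] by simp
qed

lemma det_block_matrix_row2:
  assumes "i \<noteq> j"
  shows "det (block_matrix i j a b (c + k * a) (d + k * b)) = det (block_matrix i j a b c d)"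
proof -
  have "(\<chi> s. if s = j then row j (block_matrix i j a b c d) + k *s row i (block_matrix i j a b c d)
      else row s (block_matrix i j a b c d)) = block_matrix i j a b (c + k * a) (d + k * b)"
    using assms by (auto simp: vec_eq_iff row_def block_matrix_def)
  then show ?thesis
    using det_row_operation[OF assms[symmetric], of "block_matrix i j a b c d" k] by simp
qed

text \<open>For \<open>u * v\<close> congruent to 1 this block lifts the diagonal block of
  \<open>u\<close> and \<open>v\<close>; its 2 by 2 determinant is
  \<open>u * v * (2 - u * v) + (1 - u * v)^2 = 1\<close>. Row operations lead to the identity, so
  the large determinant is never expanded.\<close>

lemma det_block_matrix_lift:
  assumes ij: "i \<noteq> j"
  shows "det (block_matrix i j u (u * v - 1) (1 - u * v) (v * (2 - u * v))) = 1"
proof -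
  have "det (block_matrix i j u (u * v - 1) (1 - u * v) (v * (2 - u * v))) = det (block_matrix i j u (u * v - 1) 1 v)"
    using det_block_matrix_row2[OF ij, of u "u * v - 1" "1 - u * v" v "v * (2 - u * v)"]
    by (simp add: algebra_simps)
  also have "\<dots> = det (block_matrix i j 0 (- 1) 1 v)"
    using det_block_matrix_row1[OF ij, of u "- u" 1 "u * v - 1" v] by simp
  also have "\<dots> = det (block_matrix i j 1 (v - 1) 1 v)"
    using det_block_matrix_row1[OF ij, of 0 1 1 "- 1" v] by simp
  also have "\<dots> = det (block_matrix i j 1 (v - 1) 0 1)"
    using det_block_matrix_row2[OF ij, of 1 "v - 1" 1 "- 1" v] by simp
  also have "\<dots> = det (block_matrix i j 1 0 0 1)"
    using det_block_matrix_row1[OF ij, of 1 "1 - v" 0 "v - 1" 1] by simp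
  also have "block_matrix i j 1 0 0 1 = mat 1"
    by (auto simp: vec_eq_iff mat_def block_matrix_def)
  finally show ?thesis by simp
qed

definition cong_diag :: "int ^ 'n ^ 'n \<Rightarrow> ('n::finite \<Rightarrow> int) \<Rightarrow> int \<Rightarrow> bool" where
  "cong_diag A a m \<longleftrightarrow> (\<forall>s t. [A $ s $ t = (if s = t then a s else 0)] (mod m))"

lemma cong_diag_mult:
  assumes "cong_diag A a m" "cong_diag B b m"
  shows "cong_diag (A ** B) (\<lambda>s. a s * b s) m"
  unfolding cong_diag_def
proof (intro allI)
  fix s t
  have "[(\<Sum>k\<in>UNIV. A $ s $ k * B $ k $ t) =
      (\<Sum>k\<in>UNIV. (if s = k then a s else 0) * (if k = t then b k else 0))] (mod m)"
    using assms unfolding cong_diag_def by (intro cong_sum cong_mult) auto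
  also have "(\<Sum>k\<in>UNIV. (if s = k then a s else 0) * (if k = t then b k else 0)) =
      (\<Sum>k\<in>UNIV. if s = k then (if k = t then a s * b k else 0) else 0)"
    by (intro sum.cong) auto
  also have "\<dots> = (if s = t then a s * b s else 0)" by simp
  finally show "[(A ** B) $ s $ t = (if s = t then a s * b s else 0)] (mod m)"
    by (simp add: matrix_matrix_mult_def)
qed

lemma cong_diag_block_matrix:
  assumes ij: "i \<noteq> j" and uv: "[u * v = 1] (mod m)"
  shows "cong_diag (block_matrix i j u (u * v - 1) (1 - u * v) (v * (2 - u * v)))
    (\<lambda>s. if s = i then u else if s = j then v else 1) m"
proof -
  have 1: "m dvd u * v - 1" using uv by (simp add: cong_iff_dvd_diff)
  then have 2: "m dvd 1 - u * v" by (metis dvd_minus_iff minus_diff_eq)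
  have "v * (2 - u * v) - v = v * (1 - u * v)" by (simp add: algebra_simps)
  then have 3: "m dvd v * (2 - u * v) - v" using 2 by simp
  show ?thesis
    unfolding cong_diag_def using ij 1 2 3
    by (auto simp: block_matrix_def cong_iff_dvd_diff)
qed

text \<open>One block for each \<open>j\<close> in \<open>J\<close> puts \<open>u\<close> at
  \<open>j\<close> and collects the compensating \<open>v\<close> at \<open>i0\<close>. The lift is
  explicit, so surjectivity of reduction is not invoked.\<close>

lemma lift_diagonal:
  fixes i0 :: "'n::finite"
  assumes uv: "[u * v = 1] (mod m)" and J: "i0 \<notin> J"
  shows "\<exists>A\<in>SL_int. cong_diag A (\<lambda>s. if s \<in> J then u else if s = i0 then v ^ card J else 1) m"
proof -
  have "finite J" by simp
  then show ?thesis using J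
  proof induction
    case empty
    have "cong_diag (mat 1) (\<lambda>s. if s \<in> {} then u else if s = i0 then v ^ card {} else 1) m"
      by (auto simp: cong_diag_def mat_def)
    then show ?case by (intro bexI[of _ "mat 1"]) (auto simp: SL_int_def)
  next
    case (insert j J)
    then obtain A where A: "A \<in> SL_int"
      "cong_diag A (\<lambda>s. if s \<in> J then u else if s = i0 then v ^ card J else 1) m"
      by auto
    define B where "B = block_matrix j i0 u (u * v - 1) (1 - u * v) (v * (2 - u * v))"
    have j: "j \<noteq> i0" using insert by auto
    have "det (A ** B) = 1"
      using A(1) det_block_matrix_lift[OF j] by (simp add: det_mul SL_int_def B_def)
    moreover have "cong_diag (A ** B) (\<lambda>s. (if s \<in> J then u else if s = i0 then v ^ card J else 1) *
        (if s = j then u else if s = i0 then v else 1)) m"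
      unfolding B_def by (intro cong_diag_mult A(2) cong_diag_block_matrix j uv)
    moreover have "(\<lambda>s. (if s \<in> J then u else if s = i0 then v ^ card J else 1) *
        (if s = j then u else if s = i0 then v else 1)) =
        (\<lambda>s. if s \<in> insert j J then u else if s = i0 then v ^ card (insert j J) else 1)"
      using insert j by (auto simp: fun_eq_iff)
    ultimately show ?case by (intro bexI[of _ "A ** B"]) (auto simp: SL_int_def)
  qed
qed

text \<open>A permutation other than the identity moves at least two points, so its term in the
  determinant contains two off-diagonal entries.\<close>
lemma det_cong_prod_diag:
  fixes A :: "int ^ 'n::finite ^ 'n"
  assumes A: "cong_diag A a m"
  shows "[det A = (\<Prod>s\<in>UNIV. A $ s $ s)] (mod m\<^sup>2)"
proof -
  let ?P = "{p. p permutes (UNIV :: 'n set)}"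
  let ?f = "\<lambda>p. of_int (sign p) * (\<Prod>s\<in>UNIV. A $ s $ p s)"
  have off: "m dvd A $ s $ t" if "s \<noteq> t" for s t
  proof -
    have "[A $ s $ t = 0] (mod m)" using A that unfolding cong_diag_def by (metis (full_types))
    then show ?thesis by (simp add: cong_0_iff)
  qed
  have "m\<^sup>2 dvd ?f p" if p: "p \<in> ?P - {id}" for p
  proof -
    obtain s where s: "p s \<noteq> s" using p by (metis DiffE eq_id_iff singletonI)
    have "inj p" using p permutes_inj by blast
    then have ps: "p (p s) \<noteq> p s" using s by (metis injD)
    have "(\<Prod>t\<in>UNIV. A $ t $ p t) =
        A $ s $ p s * A $ (p s) $ p (p s) * (\<Prod>t\<in>UNIV - {s} - {p s}. A $ t $ p t)"
      using s by (subst prod.remove[of _ s], simp, simp, subst prod.remove[of _ "p s"]) (auto simp: mult.assoc)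
    moreover have "m * m dvd A $ s $ p s * A $ (p s) $ p (p s)"
      using off[of s "p s"] off[of "p s" "p (p s)"] s ps by (intro mult_dvd_mono) auto
    ultimately have "m\<^sup>2 dvd (\<Prod>t\<in>UNIV. A $ t $ p t)"
      unfolding power2_eq_square by (simp only: dvd_mult2)
    then show ?thesis by simp
  qed
  then have "m\<^sup>2 dvd (\<Sum>p\<in>?P - {id}. ?f p)" by (rule dvd_sum)
  moreover have "det A = ?f id + (\<Sum>p\<in>?P - {id}. ?f p)"
    unfolding det_def by (intro sum.remove) (auto simp: permutes_id)
  moreover have "?f id = (\<Prod>s\<in>UNIV. A $ s $ s)" by (simp add: sign_id)
  ultimately show ?thesis by (simp add: cong_iff_dvd_diff)
qed

lemma prod_one_plus_cong:
  fixes b :: "'i \<Rightarrow> int"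
  assumes "\<And>i. i \<in> I \<Longrightarrow> m dvd b i"
  shows "[(\<Prod>i\<in>I. 1 + b i) = 1 + (\<Sum>i\<in>I. b i)] (mod m\<^sup>2)"
  using assms
proof (induction I rule: infinite_finite_induct)
  case (insert i I)
  have "m * m dvd b i * (\<Sum>i\<in>I. b i)"
    using insert by (intro mult_dvd_mono dvd_sum) auto
  then have "[(1 + b i) * (1 + (\<Sum>i\<in>I. b i)) = 1 + (b i + (\<Sum>i\<in>I. b i))] (mod m\<^sup>2)"
    by (simp add: cong_iff_dvd_diff power2_eq_square algebra_simps)
  moreover have "[(1 + b i) * (\<Prod>i\<in>I. 1 + b i) = (1 + b i) * (1 + (\<Sum>i\<in>I. b i))] (mod m\<^sup>2)"
    using insert by (intro cong_mult cong_refl) auto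
  ultimately show ?case using insert by (auto intro: cong_trans)
qed auto

text \<open>The determinant condition, linearised around the diagonal residue, determines a
  weighted trace modulo \<open>m\<^sup>2\<close> although \<open>A\<close> is only prescribed modulo \<open>m\<close>.\<close>
lemma weighted_trace_cong:
  fixes A :: "int ^ 'n::finite ^ 'n" and i0 :: 'n
  assumes det: "det A = 1" and kv: "[k * v = 1] (mod m\<^sup>2)" and kD: "[k ^ CARD('n) = D] (mod m\<^sup>2)"
    and A: "cong_diag A (\<lambda>s. if s = i0 then v ^ (CARD('n) - 1) else k) m"
  shows "[D * A $ i0 $ i0 + (\<Sum>s\<in>UNIV - {i0}. A $ s $ s) = int CARD('n) * k] (mod m\<^sup>2)"
proof -
  define N where "N = CARD('n)"
  have N: "N > 0" by (simp add: N_def)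
  \<comment> \<open>The weights make every \<open>v * w s * A $ s $ s\<close> congruent to 1 modulo
    \<open>m\<close>: at \<open>i0\<close> this is \<open>v ^ N * D\<close>, which is 1 because
    \<open>k ^ N\<close> is \<open>D\<close>. The deviations \<open>b s\<close> are then the
    first-order terms of the determinant.\<close>
  define w where "w s = (if s = i0 then D else 1)" for s
  define b where "b s = v * w s * A $ s $ s - 1" for s
  have weaken: "[x = y] (mod m)" if "[x = y] (mod m\<^sup>2)" for x y
    using that by (rule cong_dvd_modulus) simp
  have vD: "[v ^ N * D = 1] (mod m\<^sup>2)"
  proof -
    have "[v ^ N * D = v ^ N * k ^ N] (mod m\<^sup>2)"
      unfolding N_def by (rule cong_scalar_left[OF cong_sym[OF kD]])
    also have "v ^ N * k ^ N = (k * v) ^ N" by (simp add: power_mult_distrib mult.commute)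
    also have "[(k * v) ^ N = 1 ^ N] (mod m\<^sup>2)" using kv by (rule cong_pow)
    finally show ?thesis by simp
  qed
  have diag: "[A $ s $ s = (if s = i0 then v ^ (N - 1) else k)] (mod m)" for s
    using A[unfolded cong_diag_def, rule_format, of s s] by (simp only: N_def refl if_True)
  have b: "m dvd b s" for s
  proof -
    have "[v * w s * A $ s $ s = 1] (mod m)"
    proof (cases "s = i0")
      case True
      then have "[A $ s $ s = v ^ (N - 1)] (mod m)" using diag[of s] by simp
      then have "[v * w s * A $ s $ s = v * w s * v ^ (N - 1)] (mod m)"
        by (rule cong_scalar_left)
      also have "v * w s * v ^ (N - 1) = v ^ N * D"
        using N True by (cases N) (simp_all add: w_def)
      also have "[\<dots> = 1] (mod m)" by (rule weaken[OF vD])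
      finally show ?thesis .
    next
      case False
      then have "[A $ s $ s = k] (mod m)" using diag[of s] by simp
      then have "[v * A $ s $ s = v * k] (mod m)" by (rule cong_scalar_left)
      also have "[v * k = 1] (mod m)" using weaken[OF kv] by (simp add: mult.commute)
      finally show ?thesis using False by (simp add: w_def)
    qed
    then show ?thesis by (simp add: b_def cong_iff_dvd_diff)
  qed
  have "(\<Prod>s\<in>UNIV. w s) = D" by (simp add: w_def)
  then have "(\<Prod>s\<in>UNIV. 1 + b s) = v ^ N * D * (\<Prod>s\<in>UNIV. A $ s $ s)"
    by (simp add: b_def prod.distrib N_def)
  also have "[\<dots> = 1 * det A] (mod m\<^sup>2)"
    by (intro cong_mult vD cong_sym[OF det_cong_prod_diag[OF A]])
  finally have 1: "[(\<Prod>s\<in>UNIV. 1 + b s) = 1] (mod m\<^sup>2)" using det by simp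
  have "[1 + (\<Sum>s\<in>UNIV. b s) = 1] (mod m\<^sup>2)"
    using cong_trans[OF cong_sym[OF prod_one_plus_cong[of UNIV m b]] 1] b by simp
  then have "m\<^sup>2 dvd (\<Sum>s\<in>UNIV. b s)" by (simp add: cong_iff_dvd_diff)
  also have "(\<Sum>s\<in>UNIV. b s) = v * (\<Sum>s\<in>UNIV. w s * A $ s $ s) - int N"
    by (simp add: b_def sum_subtractf sum_distrib_left mult.assoc N_def)
  also have "(\<Sum>s\<in>UNIV. w s * A $ s $ s) = D * A $ i0 $ i0 + (\<Sum>s\<in>UNIV - {i0}. A $ s $ s)"
    by (subst sum.remove[of _ i0]) (simp_all add: w_def)
  finally have "[v * (D * A $ i0 $ i0 + (\<Sum>s\<in>UNIV - {i0}. A $ s $ s)) = int N] (mod m\<^sup>2)" (is "[v * ?t = _] (mod _)")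
    by (simp add: cong_iff_dvd_diff)
  \<comment> \<open>Multiplication by \<open>k\<close> undoes the normalising factor
    \<open>v\<close>.\<close>
  then have "[k * (v * ?t) = k * int N] (mod m\<^sup>2)" by (rule cong_scalar_left)
  then have "[k * v * ?t = k * int N] (mod m\<^sup>2)" by (simp only: mult.assoc)
  with cong_sym[OF cong_scalar_right[OF kv]] have "[1 * ?t = k * int N] (mod m\<^sup>2)"
    by (rule cong_trans)
  then show ?thesis by (simp add: N_def mult.commute)
qed

section \<open>Operator norms and minimal lifts\<close>

lemma abs_entry_le_op_norm: "\<bar>real_of_int (A $ i $ j)\<bar> \<le> op_norm A"
  unfolding op_norm_def
  using matrix_component_le_onorm[of "map_matrix real_of_int A" i j]
  by (simp add: map_matrix_def)

lemma op_norm_ge_1: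
  assumes "A \<in> SL_int"
  shows "op_norm A \<ge> 1"
proof -
  have "A \<noteq> 0"
  proof
    assume "A = 0"
    then have "det A = 0" using det_zero_row(1)[of undefined A] by (simp add: row_def vec_eq_iff)
    then show False using assms by (simp add: SL_int_def)
  qed
  then obtain i j where "A $ i $ j \<noteq> 0" by (metis vec_eq_iff zero_index)
  then have "1 \<le> \<bar>real_of_int (A $ i $ j)\<bar>" by linarith
  then show ?thesis using abs_entry_le_op_norm[of A i j] by linarith
qed

lemma finite_op_norm_le: "finite {A :: int ^ 'n::finite ^ 'n. op_norm A \<le> B}"
proof (rule finite_subset)
  let ?F = "UNIV \<rightarrow>\<^sub>E (UNIV \<rightarrow>\<^sub>E {- \<lfloor>B\<rfloor>..\<lfloor>B\<rfloor>}) :: ('n \<Rightarrow> 'n \<Rightarrow> int) set"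
  show "finite ((\<lambda>f. \<chi> i j. f i j) ` ?F)" by (intro finite_imageI finite_PiE) auto
  show "{A :: int ^ 'n ^ 'n. op_norm A \<le> B} \<subseteq> (\<lambda>f. \<chi> i j. f i j) ` ?F"
  proof
    fix A :: "int ^ 'n ^ 'n" assume "A \<in> {A. op_norm A \<le> B}"
    then have "\<bar>real_of_int (A $ i $ j)\<bar> \<le> B" for i j
      using abs_entry_le_op_norm[of A i j] by simp
    then have "\<bar>A $ i $ j\<bar> \<le> \<lfloor>B\<rfloor>" for i j by (metis le_floor_iff of_int_abs)
    then have "A $ i $ j \<in> {- \<lfloor>B\<rfloor>..\<lfloor>B\<rfloor>}" for i j by (metis abs_le_iff atLeastAtMost_iff minus_le_iff)
    then have "(\<lambda>i j. A $ i $ j) \<in> ?F" by auto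
    then show "A \<in> (\<lambda>f. \<chi> i j. f i j) ` ?F"
      by (rule image_eqI[rotated]) (simp add: vec_eq_iff)
  qed
qed

text \<open>Only finitely many integer matrices have norm at most that of \<open>A\<close>, so the
  minimum over the whole set is attained among them.\<close>

lemma ex_arg_min_op_norm:
  assumes "P (A :: int ^ 'n::finite ^ 'n)"
  obtains A0 where "is_arg_min op_norm P A0"
proof -
  define F where "F = {B. op_norm B \<le> op_norm A} \<inter> {B. P B}"
  have F: "finite F" "A \<in> F" using finite_op_norm_le assms by (auto simp: F_def)
  then obtain A0 where A0: "A0 \<in> F" "\<And>B. B \<in> F \<Longrightarrow> op_norm A0 \<le> op_norm B"
    using arg_min_if_finite[of F op_norm] by (metis empty_iff not_le)
  have "is_arg_min op_norm P A0"
    unfolding is_arg_min_linorder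
  proof (intro conjI allI impI)
    show "P A0" using A0 by (simp add: F_def)
    fix B assume B: "P B"
    show "op_norm A0 \<le> op_norm B"
    proof (cases "op_norm B \<le> op_norm A")
      case True
      then show ?thesis using A0 B by (simp add: F_def)
    next
      case False
      then show ?thesis using A0(2)[OF F(2)] by simp
    qed
  qed
  then show ?thesis by (rule that)
qed

lemma reduce_mod_cong: "[reduce_mod q A $ s $ t = A $ s $ t] (mod int q)"
  by (simp add: reduce_mod_def map_matrix_def cong_def)

lemma det_cong:
  fixes A B :: "int ^ 'n::finite ^ 'n"
  assumes "\<And>s t. [A $ s $ t = B $ s $ t] (mod m)"
  shows "[det A = det B] (mod m)"
  unfolding det_def by (intro cong_sum cong_mult cong_refl cong_prod assms)

lemma reduce_mod_SL:
  assumes "A \<in> SL_int" "q > 0"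
  shows "reduce_mod q A \<in> SL_mod q"
proof -
  have "[det (reduce_mod q A) = 1] (mod int q)"
    using det_cong[OF reduce_mod_cong, of q A] assms by (simp add: SL_int_def)
  moreover have "reduce_mod q A $ s $ t \<in> carrier (residue_ring (int q))" for s t
    using assms by (simp add: reduce_mod_def map_matrix_def residue_ring_def)
  ultimately show ?thesis by (simp add: SL_mod_def)
qed

text \<open>Choosing \<open>x\<close> as the reduction of an integral matrix makes its set of lifts
  nonempty. What remains is a bound for all matrices of determinant 1 congruent to
  \<open>A\<close>.\<close>

lemma lift_lower_bound:
  fixes A :: "int ^ 'n::finite ^ 'n"
  assumes q: "q > 0" and A: "A \<in> SL_int"
    and B: "\<And>\<gamma>. \<gamma> \<in> SL_int \<Longrightarrow> (\<And>s t. [\<gamma> $ s $ t = A $ s $ t] (mod int q)) \<Longrightarrow> B \<le> op_norm \<gamma>"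
  shows "\<exists>x \<in> (SL_mod q :: (int ^ 'n ^ 'n) set). \<exists>\<gamma>\<^sub>0. is_arg_min op_norm (\<lambda>\<gamma>. \<gamma> \<in> SL_int \<and> reduce_mod q \<gamma> = x) \<gamma>\<^sub>0 \<and> B \<le> op_norm \<gamma>\<^sub>0"
proof -
  obtain \<gamma>0 where \<gamma>0: "is_arg_min op_norm (\<lambda>\<gamma>. \<gamma> \<in> SL_int \<and> reduce_mod q \<gamma> = reduce_mod q A) \<gamma>0"
    using ex_arg_min_op_norm[of "\<lambda>\<gamma>. \<gamma> \<in> SL_int \<and> reduce_mod q \<gamma> = reduce_mod q A" A] A by auto
  then have g: "\<gamma>0 \<in> SL_int" "reduce_mod q \<gamma>0 = reduce_mod q A" by (auto simp: is_arg_min_def)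
  have "[\<gamma>0 $ s $ t = A $ s $ t] (mod int q)" for s t
    using reduce_mod_cong[of q \<gamma>0 s t] reduce_mod_cong[of q A s t] g(2) by (metis cong_sym cong_trans)
  then have "B \<le> op_norm \<gamma>0" by (rule B[OF g(1)])
  with \<gamma>0 show ?thesis
    by (intro bexI[of _ "reduce_mod q A"] exI[of _ \<gamma>0] conjI reduce_mod_SL[OF A q])
qed

text \<open>The power of \<open>M\<close> has two sources: \<open>M ^ (n * r)\<close> is lost in the
  residue bound \<open>Z\<close>, because each \<open>D i\<close> is at most \<open>M ^ n\<close>. A
  further \<open>M ^ (n * r * n)\<close> bounds the weight \<open>E\<close> of the corner entry in
  the trace.\<close>

lemma hard_diagonal_residue:
  fixes q r :: nat and l \<kappa> :: "nat \<Rightarrow> nat" and M :: real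
  defines "n \<equiv> CARD('n::finite)"
  assumes n2: "n \<ge> 2" and nq: "n < q\<^sup>2" and M: "M \<ge> 1"
    and inj: "inj_on l {..r}"
    and l: "\<And>i. i \<le> r \<Longrightarrow> prime (l i) \<and> \<not> l i dvd n \<and> coprime (l i) (q\<^sup>2) \<and> real (l i) \<le> M
         \<and> [\<kappa> i ^ n = l i * l r ^ (n - 1)] (mod q\<^sup>2)"
  obtains A :: "int ^ 'n ^ 'n" where "A \<in> SL_int"
    "\<And>\<gamma>. \<gamma> \<in> SL_int \<Longrightarrow> (\<And>s t. [\<gamma> $ s $ t = A $ s $ t] (mod int q)) \<Longrightarrow>
      real q powr (2 - 2 / 2 ^ r) / (2 ^ (r + 1) * (real n + 1) * M ^ (n * r * (n + 1))) \<le> op_norm \<gamma>"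
proof -
  define Q where "Q = q\<^sup>2"
  have q: "q > 0" using nq n2 by (cases q) auto
  define D where "D i = int (l i) * int (l r ^ (n - 1))" for i
  \<comment> \<open>Chosen so that the left side of the size condition in
    \<open>radical_residue_large\<close> equals \<open>Q / 2\<close>.\<close>
  define Z where "Z = real Q powr (1 - 1 / 2 ^ r) / (2 ^ (r + 1) * (M ^ n) ^ r)"
  have prime: "prime (l i)" if "i \<le> r" for i using l that by blast
  have not_dvd: "\<not> l i dvd l j" if "i \<le> r" "j \<le> r" "i \<noteq> j" for i j
    using primes_dvd_imp_eq[OF prime prime] inj that by (metis atMost_iff inj_on_def)
  have D1: "1 \<le> D i" if "i \<le> r" for i
  proof -
    have "l i * l r ^ (n - 1) > 0" using prime that by (simp add: prime_gt_0_nat)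
    then have "int 1 \<le> int (l i * l r ^ (n - 1))" by (simp only: of_nat_le_iff)
    then show ?thesis by (simp add: D_def)
  qed
  have DM: "real_of_int (D i) \<le> M ^ n" if "i \<le> r" for i
  proof -
    have "real_of_int (D i) = real (l i) * real (l r) ^ (n - 1)" by (simp add: D_def)
    also have "\<dots> \<le> M * M ^ (n - 1)"
      using l that M by (intro mult_mono power_mono) auto
    also have "\<dots> = M ^ n" using n2 by (cases n) auto
    finally show ?thesis .
  qed
  obtain e where e: "\<And>i. e i < n"
    "\<And>z. [z = int n * (\<Prod>i<r. int (\<kappa> i) ^ e i)] (mod int Q) \<Longrightarrow> Z \<le> \<bar>real_of_int z\<bar>"
  proof (rule radical_residue_large[where Q = Q and n = n and r = r and l = l and D = D
        and d = "\<lambda>_. int (l r ^ (n - 1))" and \<kappa> = "\<lambda>i. int (\<kappa> i)" and M = "M ^ n" and Z = Z])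
    show "n < Q" using nq by (simp add: Q_def)
    show "\<not> int (l i) dvd int (l r ^ (n - 1))" if "i < r" for i
    proof
      assume "int (l i) dvd int (l r ^ (n - 1))"
      then have "l i dvd l r ^ (n - 1)" by (simp only: int_dvd_int_iff)
      then have "l i dvd l r" using prime[of i] that by (auto dest: prime_dvd_power)
      then show False using not_dvd[of i r] that by simp
    qed
    show "\<not> int (l j) dvd D i" if "i < j" "j < r" for i j
    proof
      assume "int (l j) dvd D i"
      then have "l j dvd l i * l r ^ (n - 1)" by (simp add: D_def flip: of_nat_mult of_nat_power)
      then have "l j dvd l i \<or> l j dvd l r"
        using prime[of j] that by (meson less_imp_le prime_dvd_mult_iff prime_dvd_power)
      then show False using not_dvd that by auto
    qed
    show "[int (\<kappa> i) ^ n = D i] (mod int Q)" if "i < r" for i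
      using l[of i] that cong_int_iff[of "\<kappa> i ^ n" "l i * l r ^ (n - 1)" "q\<^sup>2"]
      by (simp add: D_def Q_def)
    have "real Q powr (1 / 2 ^ r) * real Q powr (1 - 1 / 2 ^ r) = real Q"
      using q by (simp add: Q_def flip: powr_add)
    then have "2 ^ r * real Q powr (1 / 2 ^ r) * (M ^ n) ^ r * Z = real Q / 2"
      using M by (simp add: Z_def field_simps)
    moreover have "real Q / 2 < real Q" using q by (simp add: Q_def)
    ultimately show "2 ^ r * real Q powr (1 / 2 ^ r) * (M ^ n) ^ r * Z < real Q"
      by (simp only:)
    show "1 \<le> D i \<and> real_of_int (D i) \<le> M ^ n" if "i < r" for i
      using D1 DM that by simp
  qed (use n2 l M in \<open>auto simp: D_def\<close>)
  define k where "k = (\<Prod>i<r. int (\<kappa> i) ^ e i)"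
  define E where "E = (\<Prod>i<r. D i ^ e i)"
  have "[(\<Prod>i<r. (int (\<kappa> i) ^ n) ^ e i) = E] (mod int Q)"
    unfolding E_def
  proof (intro cong_prod cong_pow)
    fix i assume "i \<in> {..<r}"
    then show "[int (\<kappa> i) ^ n = D i] (mod int Q)"
      using l[of i] cong_int_iff[of "\<kappa> i ^ n" "l i * l r ^ (n - 1)" "q\<^sup>2"]
      by (simp add: D_def Q_def)
  qed
  moreover have "(\<Prod>i<r. (int (\<kappa> i) ^ n) ^ e i) = k ^ n"
    unfolding k_def prod_power_distrib by (simp add: mult.commute flip: power_mult)
  ultimately have kE: "[k ^ n = E] (mod int Q)" by simp
  have "coprime (D i) (int Q)" if "i \<le> r" for i
    using l[OF that] l[of r] by (simp add: D_def Q_def)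
  then have "coprime E (int Q)" unfolding E_def by (intro prod_coprime_left) auto
  then have "coprime (k ^ n) (int Q)" using kE by (metis cong_imp_coprime cong_sym)
  then have "coprime k (int Q)" using n2 by simp
  then obtain v where v: "[k * v = 1] (mod int Q)" using cong_solve_coprime_int by auto
  have E1: "1 \<le> real_of_int E"
    unfolding E_def of_int_prod using D1 by (intro prod_ge_1) (auto intro!: one_le_power)
  have EM: "real_of_int E \<le> M ^ (n * r * n)"
  proof -
    have "real_of_int E \<le> (\<Prod>i<r. (M ^ n) ^ n)"
      unfolding E_def of_int_prod
    proof (intro prod_mono conjI)
      fix i assume i: "i \<in> {..<r}"
      then have "1 \<le> real_of_int (D i)" using D1[of i] by simp
      then show "0 \<le> real_of_int (D i ^ e i)" by simp
      have "real_of_int (D i ^ e i) \<le> (M ^ n) ^ e i"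
        using i DM[of i] \<open>1 \<le> real_of_int (D i)\<close> by (simp add: power_mono)
      also have "\<dots> \<le> (M ^ n) ^ n" using M e(1)[of i] by (intro power_increasing) auto
      finally show "real_of_int (D i ^ e i) \<le> (M ^ n) ^ n" .
    qed
    then show ?thesis by (simp add: mult_ac flip: power_mult)
  qed
  obtain i0 :: 'n where True by auto
  \<comment> \<open>Here \<open>v\<close> inverts \<open>k\<close> modulo \<open>q^2\<close>, as the
    weighted trace requires; the diagonal shape of \<open>A\<close> is then passed down to modulus
    \<open>q\<close>.\<close>
  obtain A where A: "A \<in> SL_int"
    "cong_diag A (\<lambda>s. if s \<in> UNIV - {i0} then k else if s = i0 then v ^ card (UNIV - {i0}) else 1) (int Q)"
    using lift_diagonal[OF v, of i0 "UNIV - {i0}"] by auto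
  have card_eq: "card (UNIV - {i0}) = n - 1" by (simp add: n_def)
  have Adiag: "[A $ s $ t = (if s = t then (if s = i0 then v ^ (n - 1) else k) else 0)] (mod int q)" for s t
  proof -
    have "[A $ s $ t = (if s = t then (if s = i0 then v ^ (n - 1) else k) else 0)] (mod int Q)"
      using A(2)[unfolded cong_diag_def card_eq, rule_format, of s t] by (auto split: if_splits)
    then show ?thesis by (rule cong_dvd_modulus) (simp add: Q_def)
  qed
  have "real q powr (2 - 2 / 2 ^ r) / (2 ^ (r + 1) * (real n + 1) * M ^ (n * r * (n + 1))) \<le> op_norm \<gamma>"
    if \<gamma>: "\<gamma> \<in> SL_int" "\<And>s t. [\<gamma> $ s $ t = A $ s $ t] (mod int q)" for \<gamma>
  proof -
    define z where "z = E * \<gamma> $ i0 $ i0 + (\<Sum>s\<in>UNIV - {i0}. \<gamma> $ s $ s)"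
    have "[z = int CARD('n) * k] (mod (int q)\<^sup>2)"
      unfolding z_def
    proof (rule weighted_trace_cong)
      show "cong_diag \<gamma> (\<lambda>s. if s = i0 then v ^ (CARD('n) - 1) else k) (int q)"
        unfolding cong_diag_def using cong_trans[OF \<gamma>(2) Adiag] unfolding n_def by blast
      show "[k * v = 1] (mod (int q)\<^sup>2)" using v by (simp add: Q_def)
      show "[k ^ CARD('n) = E] (mod (int q)\<^sup>2)" using kE by (simp add: Q_def n_def)
    qed (use \<gamma>(1) in \<open>simp add: SL_int_def\<close>)
    then have "Z \<le> \<bar>real_of_int z\<bar>"
      by (intro e(2)) (simp add: n_def k_def Q_def)
    also have "\<dots> \<le> \<bar>real_of_int E * real_of_int (\<gamma> $ i0 $ i0)\<bar> + \<bar>\<Sum>s\<in>UNIV - {i0}. real_of_int (\<gamma> $ s $ s)\<bar>"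
      unfolding z_def of_int_add of_int_mult of_int_sum by (rule abs_triangle_ineq)
    also have "\<dots> \<le> real_of_int E * op_norm \<gamma> + real n * op_norm \<gamma>"
    proof (rule add_mono)
      show "\<bar>real_of_int E * real_of_int (\<gamma> $ i0 $ i0)\<bar> \<le> real_of_int E * op_norm \<gamma>"
        using E1 abs_entry_le_op_norm[of \<gamma> i0 i0] by (simp add: abs_mult)
      have "\<bar>\<Sum>s\<in>UNIV - {i0}. real_of_int (\<gamma> $ s $ s)\<bar> \<le> (\<Sum>s\<in>UNIV - {i0}. \<bar>real_of_int (\<gamma> $ s $ s)\<bar>)"
        by (rule sum_abs)
      also have "\<dots> \<le> (\<Sum>s\<in>UNIV - {i0}. op_norm \<gamma>)"
        by (intro sum_mono abs_entry_le_op_norm)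
      also have "\<dots> = real (n - 1) * op_norm \<gamma>" by (simp only: sum_constant card_eq)
      also have "\<dots> \<le> real n * op_norm \<gamma>"
        using op_norm_ge_1[OF \<gamma>(1)] by (intro mult_right_mono) auto
      finally show "\<bar>\<Sum>s\<in>UNIV - {i0}. real_of_int (\<gamma> $ s $ s)\<bar> \<le> real n * op_norm \<gamma>" .
    qed
    also have "\<dots> = (real_of_int E + real n) * op_norm \<gamma>" by (simp add: algebra_simps)
    also have "\<dots> \<le> ((real n + 1) * M ^ (n * r * n)) * op_norm \<gamma>"
    proof (rule mult_right_mono)
      have "real n * 1 \<le> real n * M ^ (n * r * n)" using M by (intro mult_left_mono one_le_power) auto
      with EM show "real_of_int E + real n \<le> (real n + 1) * M ^ (n * r * n)"
        by (simp add: algebra_simps)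
      show "0 \<le> op_norm \<gamma>" using op_norm_ge_1[OF \<gamma>(1)] by simp
    qed
    finally have "Z / ((real n + 1) * M ^ (n * r * n)) \<le> op_norm \<gamma>"
      using M by (simp add: divide_le_eq mult.commute)
    moreover have "real Q powr (1 - 1 / 2 ^ r) = real q powr (2 - 2 / 2 ^ r)"
    proof -
      have "real Q = real q powr 2" using q by (simp add: Q_def powr_numeral)
      moreover have "(real q powr 2) powr (1 - 1 / 2 ^ r) = real q powr (2 - 2 / 2 ^ r)"
        by (simp only: powr_powr right_diff_distrib) simp
      ultimately show ?thesis by (simp only:)
    qed
    moreover have "(M ^ n) ^ r * M ^ (n * r * n) = M ^ (n * r * (n + 1))"
      by (simp add: distrib_left power_add flip: power_mult)
    ultimately show ?thesis by (simp add: Z_def mult_ac)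
  qed
  with A(1) show ?thesis by (rule that)
qed

theorem theorem1p2:
  assumes "CARD('n::finite) \<ge> 2"
  shows "\<forall>\<epsilon>::real. \<epsilon> > 0 \<longrightarrow> (\<exists>C::real. C > 0 \<and>
    (\<forall>q::nat. q > 0 \<longrightarrow>
      (\<exists>x \<in> (SL_mod q :: (int ^ 'n ^ 'n) set).
        \<exists>\<gamma>\<^sub>0. is_arg_min op_norm (\<lambda>\<gamma>. \<gamma> \<in> SL_int \<and> reduce_mod q \<gamma> = x) \<gamma>\<^sub>0 \<and>
          op_norm \<gamma>\<^sub>0 \<ge> C * real q powr (2 - \<epsilon>))))"
proof (intro allI impI)
  fix \<epsilon> :: real assume \<epsilon>: "\<epsilon> > 0"
  define n where "n = CARD('n)"
  have n2: "n \<ge> 2" using assms by (simp add: n_def)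
  \<comment> \<open>The pigeonhole argument costs \<open>2 / 2 ^ r\<close> in the exponent of
    \<open>q\<close>, which this \<open>r\<close> keeps within half of
    \<open>\<epsilon>\<close>.\<close>
  obtain r :: nat where r: "4 / \<epsilon> < 2 ^ r" using real_arch_pow[of 2 "4 / \<epsilon>"] by auto
  have r\<epsilon>: "2 / 2 ^ r \<le> \<epsilon> / 2" using r \<epsilon> by (simp add: field_simps)
  define m where "m = n * r * (n + 1)"
  \<comment> \<open>The primes cost \<open>\<delta> * m\<close> in the exponent, the other half of
    \<open>\<epsilon>\<close>. The added 1 covers \<open>m = 0\<close>, which occurs for
    \<open>r = 0\<close>.\<close>
  define \<delta> where "\<delta> = \<epsilon> / (2 * (real m + 1))"
  have \<delta>: "\<delta> > 0" using \<epsilon> by (simp add: \<delta>_def)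
  have \<delta>m: "\<delta> * real m \<le> \<epsilon> / 2" using \<epsilon> by (simp add: \<delta>_def field_simps)
  obtain C1 where C1: "C1 \<ge> 1"
    "\<And>q::nat. q > 0 \<Longrightarrow> \<exists>(l :: nat \<Rightarrow> nat) (\<kappa> :: nat \<Rightarrow> nat).
      inj_on l {..r} \<and>
      (\<forall>i\<le>r. prime (l i) \<and> \<not> l i dvd n \<and> coprime (l i) (q\<^sup>2) \<and> real (l i) \<le> C1 * real q powr \<delta>
         \<and> [\<kappa> i ^ n = l i * l r ^ (n - 1)] (mod q\<^sup>2))"
    using radical_primes[of n \<delta> r] n2 \<delta> by (metis not_numeral_le_zero zero_less_iff_neq_zero)
  define c where "c = 1 / (2 ^ (r + 1) * (real n + 1) * C1 ^ m)"
  \<comment> \<open>The term \<open>1 / n\<close> serves the moduli with \<open>q^2 \<le> n\<close>: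
    there the claimed bound is at most 1, and every integral matrix of determinant 1 has norm at
    least 1.\<close>
  define C where "C = min c (1 / real n)"
  have c: "c > 0" using C1 by (simp add: c_def)
  have C: "C > 0" "C \<le> c" "C \<le> 1 / real n" using c n2 by (auto simp: C_def)
  moreover have "\<exists>x \<in> (SL_mod q :: (int ^ 'n ^ 'n) set).
        \<exists>\<gamma>\<^sub>0. is_arg_min op_norm (\<lambda>\<gamma>. \<gamma> \<in> SL_int \<and> reduce_mod q \<gamma> = x) \<gamma>\<^sub>0 \<and>
          op_norm \<gamma>\<^sub>0 \<ge> C * real q powr (2 - \<epsilon>)" if q: "q > 0" for q :: nat
  proof (cases "n < q\<^sup>2")
    case True
    define M where "M = C1 * real q powr \<delta>"
    have "1 \<le> real q powr \<delta>" using q \<delta> by (intro ge_one_powr_ge_zero) auto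
    then have M: "M \<ge> 1" using mult_mono[of 1 C1 1 "real q powr \<delta>"] C1 by (simp add: M_def)
    have Mm: "M ^ m = C1 ^ m * real q powr (\<delta> * real m)"
      using q by (simp add: M_def power_mult_distrib powr_power mult.commute)
    obtain l \<kappa> :: "nat \<Rightarrow> nat" where l: "inj_on l {..r}"
      "\<And>i. i \<le> r \<Longrightarrow> prime (l i) \<and> \<not> l i dvd n \<and> coprime (l i) (q\<^sup>2) \<and> real (l i) \<le> M
         \<and> [\<kappa> i ^ n = l i * l r ^ (n - 1)] (mod q\<^sup>2)"
      using C1(2)[OF q] unfolding M_def by blast
    obtain A :: "int ^ 'n ^ 'n" where A: "A \<in> SL_int"
      "\<And>\<gamma>. \<gamma> \<in> SL_int \<Longrightarrow> (\<And>s t. [\<gamma> $ s $ t = A $ s $ t] (mod int q)) \<Longrightarrow>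
        real q powr (2 - 2 / 2 ^ r) / (2 ^ (r + 1) * (real n + 1) * M ^ m) \<le> op_norm \<gamma>"
      using hard_diagonal_residue[where 'n = 'n, of q M l r \<kappa>] n2 True M l unfolding n_def m_def by metis
    have "C * real q powr (2 - \<epsilon>) \<le> c * real q powr (2 - \<epsilon>)" using C by (intro mult_right_mono) auto
    also have "\<dots> \<le> c * real q powr (2 - 2 / 2 ^ r - \<delta> * real m)"
      using c q r\<epsilon> \<delta>m by (intro mult_left_mono powr_mono) auto
    also have "\<dots> = real q powr (2 - 2 / 2 ^ r) / (2 ^ (r + 1) * (real n + 1) * M ^ m)"
      by (simp add: c_def Mm powr_diff)
    finally have "C * real q powr (2 - \<epsilon>) \<le> \<dots>" .
    then show ?thesis using A by (intro lift_lower_bound[OF q A(1)]) (meson order_trans)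
  next
    case False
    have "real q powr (2 - \<epsilon>) \<le> real q powr 2" using q \<epsilon> by (intro powr_mono) auto
    also have "\<dots> = real (q\<^sup>2)" using q by (simp add: powr_numeral)
    also have "\<dots> \<le> real n" using False by (intro of_nat_mono) simp
    finally have "C * real q powr (2 - \<epsilon>) \<le> 1 / real n * real n"
      using C by (intro mult_mono) auto
    then have 1: "C * real q powr (2 - \<epsilon>) \<le> 1" using n2 by simp
    have "mat 1 \<in> (SL_int :: (int ^ 'n ^ 'n) set)" by (simp add: SL_int_def)
    then show ?thesis using 1 op_norm_ge_1
      by (intro lift_lower_bound[OF q, of "mat 1"]) (auto intro: order_trans)
  qed
  ultimately show "\<exists>C>0. \<forall>q>0. \<exists>x \<in> (SL_mod q :: (int ^ 'n ^ 'n) set).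
        \<exists>\<gamma>\<^sub>0. is_arg_min op_norm (\<lambda>\<gamma>. \<gamma> \<in> SL_int \<and> reduce_mod q \<gamma> = x) \<gamma>\<^sub>0 \<and>
          op_norm \<gamma>\<^sub>0 \<ge> C * real q powr (2 - \<epsilon>)" by blast
qed

end
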